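(* Consider the descriptor system $$A_nx(n+2)+B_nx(n+1)+C_nx(n)+D_nu(n)=f(n)\quad\text{for all } n\ge n_0,$$ with $A_n,B_n,C_n\in\mathbb R^{m,d}$, $D_n\in\mathbb R^{m,p}$, $x(n)\in\mathbb R^d$, $u(n)\in\mathbb R^p$, $f(n)\in\mathbb R^m$. (i) There exist two pointwise nonsingular matrix sequences $\{U_n\}_{n\ge n_0}$ in $\mathbb R^{m,m}$ and $\{V_n\}_{n\ge n_0}$ in $\mathbb R^{p,p}$ such that by scaling the system with $U_n$, and setting $u(n)=V_nv(n)$ and $\tilde f(n):=U_nf(n)$, the system is transformed to $$\begin{bmatrix} A_{n,1} & B_{n,1} & C_{n,1} \\ 0 & B_{n,2} & C_{n,2} \\ 0 & 0 & C_{n,3} \\ 0 & B_{n,4} & C_{n,4} \\ 0 & 0 & C_{n,5} \\ 0 & 0 & 0 \end{bmatrix} \begin{bmatrix} x(n+2) \\ x(n+1) \\ x(n) \end{bmatrix} + \begin{bmatrix} D_{n,1} & 0 & 0 \\ 0 & 0 & 0 \\ 0 & 0 & 0 \\ 0 & \Sigma_{n,1} & 0 \\ 0 & 0 & \Sigma_{n,0} \\ 0 & 0 & 0 \end{bmatrix} \begin{bmatrix} v_1(n) \\ v_2(n) \\ v_3(n) \end{bmatrix} = \tilde f(n)\quad\text{for all }n\ge n_0,$$ where $v(n)=[v_1(n)^T\ v_2(n)^T\ v_3(n)^T]^T$, the block rows have sizes $r_{2,n},r_{1,n},r_{0,n},\varphi_{1,n},\varphi_{0,n},v_n$, the matrices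 $A_{n,1},B_{n,2},B_{n,4},C_{n,3}$ have full row rank, and $\Sigma_{n,1},\Sigma_{n,0}$ are nonsingular and diagonal. (ii) Furthermore, if the matrix $\begin{bmatrix}A_{n,1}^T&B_{n+1,2}^T&C_{n+2,3}^T\end{bmatrix}^T$ has full row rank for all $n\ge n_0$, then there exists a first order feedback of the form $$v(n)=F_{n,1}x(n+1)+F_{n,0}x(n)$$ such that the closed-loop system $$A_nx(n+2)+(B_n+D_nV_nF_{n,1})x(n+1)+(C_n+D_nV_nF_{n,0})x(n)=f(n)$$ is strangeness-free.
   Context: Here $F_{n,1},F_{n,0}\in\mathbb R^{p,d}$. Block rows or columns may be empty. **Strangeness-free.** A system $\mathcal A_nx(n+2)+\mathcal B_nx(n+1)+\mathcal C_nx(n)=g(n)$, $n\ge n_0$, with coefficients in $\mathbb R^{m,d}$, is called strangeness-free if there exists a pointwise nonsingular matrix sequence $\{P_n\}_{n\ge n_0}$ in $\mathbb R^{m,m}$ such that scaling the system at each $n$ with $P_n$ gives a system of the form $$\begin{bmatrix} \hat A_{n,1} \\ 0 \\ 0 \\ 0 \end{bmatrix}x(n+2)+\begin{bmatrix} \hat B_{n,1} \\ \hat B_{n,2} \\ 0 \\ 0 \end{bmatrix}x(n+1)+\begin{bmatrix} \hat C_{n,1} \\ \hat C_{n,2} \\ \hat C_{n,3} \\ 0 \end{bmatrix}x(n)=\begin{bmatrix} \hat f_1(n) \\ \hat f_2(n) \\ \hat f_3(n) \\ \hat f_4(n) \end{bmatrix}\quad\text{for all } n\ge n_0,$$ with block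 rows of sizes $\hat r_2,\hat r_1,\hat r_0,\hat v$ (not depending on $n$), where the matrix $\begin{bmatrix}\hat A_{n,1}^T&\hat B_{n+1,2}^T&\hat C_{n+2,3}^T\end{bmatrix}^T$ has full row rank for all $n\ge n_0$.
   Formalization: In (ii), strangeness-freeness with block sizes independent of n is concluded only when r_{2,n}, r_{1,n}, r_{0,n} do not depend on n (it can fail otherwise); in general the same feedback gives the strangeness-free form with block sizes that may depend on n. *)

theory Defs
  imports "Jordan_Normal_Form.DL_Rank"
begin

definition nonsingular :: "nat \<Rightarrow> real mat \<Rightarrow> bool" where
  "nonsingular k M \<longleftrightarrow> M \<in> carrier_mat k k \<and> invertible_mat M"

text \<open>
  The first argument of \<^const>\<open>vec_space.rank\<close> is the dimension of the space the columns live in,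
  i.e. the number of rows. A matrix without rows has full row rank.
\<close>

definition full_row_rank :: "real mat \<Rightarrow> bool" where
  "full_row_rank M \<longleftrightarrow> vec_space.rank (dim_row M) M = dim_row M"

definition append_cols :: "real mat \<Rightarrow> real mat \<Rightarrow> real mat" (infixr \<open>@\<^sub>c\<close> 65) where
  "M @\<^sub>c N = four_block_mat M N (0\<^sub>m 0 (dim_col M)) (0\<^sub>m 0 (dim_col N))"

definition descriptor_system ::
  "nat \<Rightarrow> (nat \<Rightarrow> real mat) \<Rightarrow> (nat \<Rightarrow> real mat) \<Rightarrow> (nat \<Rightarrow> real mat) \<Rightarrow> (nat \<Rightarrow> real mat) \<Rightarrow>
   (nat \<Rightarrow> real vec) \<Rightarrow> (nat \<Rightarrow> real vec) \<Rightarrow> (nat \<Rightarrow> real vec) \<Rightarrow> bool" where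
  "descriptor_system n0 A B C D f x u \<longleftrightarrow>
     (\<forall>n\<ge>n0. A n *\<^sub>v x (n + 2) + B n *\<^sub>v x (n + 1) + C n *\<^sub>v x n + D n *\<^sub>v u n = f n)"

text \<open>
  Strangeness-freeness concerns the coefficients only: scaling by \<open>P n\<close> replaces the right-hand
  side \<open>g n\<close> by \<open>P n *\<^sub>v g n\<close>, whose block components are unrestricted.
  The sizes of the block rows (\<open>s2\<close>, \<open>s1\<close>, \<open>s0\<close>, \<open>w\<close>) are first allowed to depend on \<open>n\<close>;
  in a strangeness-free system they are constant.
\<close>

definition strangeness_free_with_sizes ::
  "nat \<Rightarrow> nat \<Rightarrow> nat \<Rightarrow> (nat \<Rightarrow> nat) \<Rightarrow> (nat \<Rightarrow> nat) \<Rightarrow> (nat \<Rightarrow> nat) \<Rightarrow> (nat \<Rightarrow> nat) \<Rightarrow>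
   (nat \<Rightarrow> real mat) \<Rightarrow> (nat \<Rightarrow> real mat) \<Rightarrow> (nat \<Rightarrow> real mat) \<Rightarrow> bool" where
  "strangeness_free_with_sizes n0 m d s2 s1 s0 w A B C \<longleftrightarrow>
     (\<exists>P A1 B1 B2 C1 C2 C3.
        (\<forall>n\<ge>n0. nonsingular m (P n) \<and>
           s2 n + s1 n + s0 n + w n = m \<and>
           A1 n \<in> carrier_mat (s2 n) d \<and> B1 n \<in> carrier_mat (s2 n) d \<and> C1 n \<in> carrier_mat (s2 n) d \<and>
           B2 n \<in> carrier_mat (s1 n) d \<and> C2 n \<in> carrier_mat (s1 n) d \<and>
           C3 n \<in> carrier_mat (s0 n) d \<and>
           P n * A n = A1 n @\<^sub>r 0\<^sub>m (s1 n) d @\<^sub>r 0\<^sub>m (s0 n) d @\<^sub>r 0\<^sub>m (w n) d \<and>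
           P n * B n = B1 n @\<^sub>r B2 n        @\<^sub>r 0\<^sub>m (s0 n) d @\<^sub>r 0\<^sub>m (w n) d \<and>
           P n * C n = C1 n @\<^sub>r C2 n        @\<^sub>r C3 n        @\<^sub>r 0\<^sub>m (w n) d) \<and>
        (\<forall>n\<ge>n0. full_row_rank (A1 n @\<^sub>r B2 (n + 1) @\<^sub>r C3 (n + 2))))"

definition strangeness_free ::
  "nat \<Rightarrow> nat \<Rightarrow> nat \<Rightarrow> (nat \<Rightarrow> real mat) \<Rightarrow> (nat \<Rightarrow> real mat) \<Rightarrow> (nat \<Rightarrow> real mat) \<Rightarrow> bool" where
  "strangeness_free n0 m d A B C \<longleftrightarrow>
     (\<exists>s2 s1 s0 w. strangeness_free_with_sizes n0 m d (\<lambda>_. s2) (\<lambda>_. s1) (\<lambda>_. s0) (\<lambda>_. w) A B C)"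

text \<open>The sizes and blocks of the condensed form at a single time \<open>n\<close>.\<close>

record condensed_blocks =
  sz_r2 :: nat
  sz_r1 :: nat
  sz_r0 :: nat
  sz_phi1 :: nat
  sz_phi0 :: nat
  sz_v :: nat
  blk_A1 :: "real mat"
  blk_B1 :: "real mat"
  blk_B2 :: "real mat"
  blk_B4 :: "real mat"
  blk_C1 :: "real mat"
  blk_C2 :: "real mat"
  blk_C3 :: "real mat"
  blk_C4 :: "real mat"
  blk_C5 :: "real mat"
  blk_D1 :: "real mat"
  blk_Sigma1 :: "real mat"
  blk_Sigma0 :: "real mat"

definition condensed_A :: "nat \<Rightarrow> condensed_blocks \<Rightarrow> real mat" where
  "condensed_A d K =
     blk_A1 K @\<^sub>r 0\<^sub>m (sz_r1 K) d @\<^sub>r 0\<^sub>m (sz_r0 K) d @\<^sub>r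
     0\<^sub>m (sz_phi1 K) d @\<^sub>r 0\<^sub>m (sz_phi0 K) d @\<^sub>r 0\<^sub>m (sz_v K) d"

definition condensed_B :: "nat \<Rightarrow> condensed_blocks \<Rightarrow> real mat" where
  "condensed_B d K =
     blk_B1 K @\<^sub>r blk_B2 K @\<^sub>r 0\<^sub>m (sz_r0 K) d @\<^sub>r
     blk_B4 K @\<^sub>r 0\<^sub>m (sz_phi0 K) d @\<^sub>r 0\<^sub>m (sz_v K) d"

definition condensed_C :: "nat \<Rightarrow> condensed_blocks \<Rightarrow> real mat" where
  "condensed_C d K =
     blk_C1 K @\<^sub>r blk_C2 K @\<^sub>r blk_C3 K @\<^sub>r
     blk_C4 K @\<^sub>r blk_C5 K @\<^sub>r 0\<^sub>m (sz_v K) d"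

text \<open>
  The three block columns have widths \<open>p - (\<phi>\<^sub>1 + \<phi>\<^sub>0)\<close>, \<open>\<phi>\<^sub>1\<close> and \<open>\<phi>\<^sub>0\<close>; they act on the
  consecutive parts of \<open>v n = v\<^sub>1 n @\<^sub>v v\<^sub>2 n @\<^sub>v v\<^sub>3 n\<close>.
\<close>

definition condensed_D :: "nat \<Rightarrow> condensed_blocks \<Rightarrow> real mat" where
  "condensed_D p K =
     (let q = p - (sz_phi1 K + sz_phi0 K); k1 = sz_phi1 K; k0 = sz_phi0 K in
      (blk_D1 K             @\<^sub>c 0\<^sub>m (sz_r2 K) k1 @\<^sub>c 0\<^sub>m (sz_r2 K) k0) @\<^sub>r
      (0\<^sub>m (sz_r1 K) q      @\<^sub>c 0\<^sub>m (sz_r1 K) k1 @\<^sub>c 0\<^sub>m (sz_r1 K) k0) @\<^sub>r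
      (0\<^sub>m (sz_r0 K) q      @\<^sub>c 0\<^sub>m (sz_r0 K) k1 @\<^sub>c 0\<^sub>m (sz_r0 K) k0) @\<^sub>r
      (0\<^sub>m k1 q             @\<^sub>c blk_Sigma1 K    @\<^sub>c 0\<^sub>m k1 k0) @\<^sub>r
      (0\<^sub>m k0 q             @\<^sub>c 0\<^sub>m k0 k1        @\<^sub>c blk_Sigma0 K) @\<^sub>r
      (0\<^sub>m (sz_v K) q       @\<^sub>c 0\<^sub>m (sz_v K) k1  @\<^sub>c 0\<^sub>m (sz_v K) k0))"

definition admissible_blocks :: "nat \<Rightarrow> nat \<Rightarrow> nat \<Rightarrow> condensed_blocks \<Rightarrow> bool" where
  "admissible_blocks m d p K \<longleftrightarrow>
     sz_r2 K + sz_r1 K + sz_r0 K + sz_phi1 K + sz_phi0 K + sz_v K = m \<and>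
     sz_phi1 K + sz_phi0 K \<le> p \<and>
     blk_A1 K \<in> carrier_mat (sz_r2 K) d \<and> blk_B1 K \<in> carrier_mat (sz_r2 K) d \<and>
     blk_C1 K \<in> carrier_mat (sz_r2 K) d \<and>
     blk_B2 K \<in> carrier_mat (sz_r1 K) d \<and> blk_C2 K \<in> carrier_mat (sz_r1 K) d \<and>
     blk_C3 K \<in> carrier_mat (sz_r0 K) d \<and>
     blk_B4 K \<in> carrier_mat (sz_phi1 K) d \<and> blk_C4 K \<in> carrier_mat (sz_phi1 K) d \<and>
     blk_C5 K \<in> carrier_mat (sz_phi0 K) d \<and>
     blk_D1 K \<in> carrier_mat (sz_r2 K) (p - (sz_phi1 K + sz_phi0 K)) \<and>
     full_row_rank (blk_A1 K) \<and> full_row_rank (blk_B2 K) \<and>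
     full_row_rank (blk_B4 K) \<and> full_row_rank (blk_C3 K) \<and>
     nonsingular (sz_phi1 K) (blk_Sigma1 K) \<and> diagonal_mat (blk_Sigma1 K) \<and>
     nonsingular (sz_phi0 K) (blk_Sigma0 K) \<and> diagonal_mat (blk_Sigma0 K)"

definition condensed_form ::
  "nat \<Rightarrow> nat \<Rightarrow> nat \<Rightarrow> nat \<Rightarrow>
   (nat \<Rightarrow> real mat) \<Rightarrow> (nat \<Rightarrow> real mat) \<Rightarrow> (nat \<Rightarrow> real mat) \<Rightarrow> (nat \<Rightarrow> real mat) \<Rightarrow>
   (nat \<Rightarrow> real mat) \<Rightarrow> (nat \<Rightarrow> real mat) \<Rightarrow> (nat \<Rightarrow> condensed_blocks) \<Rightarrow> bool" where
  "condensed_form n0 m d p A B C D U V K \<longleftrightarrow>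
     (\<forall>n\<ge>n0. nonsingular m (U n) \<and> nonsingular p (V n) \<and> admissible_blocks m d p (K n) \<and>
        U n * A n = condensed_A d (K n) \<and>
        U n * B n = condensed_B d (K n) \<and>
        U n * C n = condensed_C d (K n) \<and>
        U n * D n * V n = condensed_D p (K n))"

end

theory Submission
  imports Defs
begin

text \<open>
  Row operations and a rank normal form do everything. First compress the rows of \<open>A\<close>. On the
  remaining rows bring the input matrix to the form \<open>[0; [0 I]]\<close>: the rows without input are compressed
  against \<open>B\<close> and then \<open>C\<close>, while the rows with input are compressed against \<open>B\<close> by some \<open>T\<close>, whose
  effect on the identity block is undone by the column operation \<open>T\<^sup>-\<^sup>1\<close>; thus \<open>\<Sigma>\<^sub>1\<close> and \<open>\<Sigma>\<^sub>0\<close>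
  become identities. These rows do not involve \<open>x (n + 2)\<close>, so they can be used to clear the input
  columns of the leading block row without touching \<open>A\<^sub>1\<close>.

  For the second part take \<open>v\<^sub>1 = 0\<close> and let \<open>v\<^sub>2\<close>, \<open>v\<^sub>3\<close> cancel the two block rows that contain
  \<open>\<Sigma>\<^sub>1\<close> and \<open>\<Sigma>\<^sub>0\<close>. Those rows become zero, and what is left is the strangeness-free form.
\<close>

subsection \<open>Block rows and block columns\<close>

text \<open>A stack is a four-block matrix whose right block column has width zero. With the sizes
  written out, \<open>mult_four_block_mat\<close> applies to stacks.\<close>

lemma append_rows_block:
  assumes "X \<in> carrier_mat a c" "Y \<in> carrier_mat b c"
  shows "X @\<^sub>r Y = four_block_mat X (0\<^sub>m a 0) Y (0\<^sub>m b 0)"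
  using assms by (simp add: append_rows_def)

lemma append_cols_carrier [simp, intro]:
  assumes "X \<in> carrier_mat a c" "Y \<in> carrier_mat a e"
  shows "X @\<^sub>c Y \<in> carrier_mat a (c + e)"
  using assms unfolding append_cols_def carrier_mat_def by auto

lemma append_rows_assoc:
  assumes "X \<in> carrier_mat a c" "Y \<in> carrier_mat b c" "Z \<in> carrier_mat e c"
  shows "(X @\<^sub>r Y) @\<^sub>r Z = X @\<^sub>r Y @\<^sub>r Z"
proof (rule eq_matI)
  show "((X @\<^sub>r Y) @\<^sub>r Z) $$ (i, j) = (X @\<^sub>r Y @\<^sub>r Z) $$ (i, j)"
    if "i < dim_row (X @\<^sub>r Y @\<^sub>r Z)" "j < dim_col (X @\<^sub>r Y @\<^sub>r Z)" for i j
    using that assms by (auto simp: append_rows_def)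
qed (use assms in \<open>auto simp: append_rows_def\<close>)

text \<open>Flattens the pairs that remain after a permutation of whole groups of rows into the
  plain list of block rows used by the condensed form.\<close>

lemma append_rows_regroup:
  assumes "X \<in> carrier_mat a c" "Y \<in> carrier_mat b c" "Z \<in> carrier_mat e c"
    and "W \<in> carrier_mat g c" "V \<in> carrier_mat h c"
  shows "(X @\<^sub>r Y) @\<^sub>r (Z @\<^sub>r W) @\<^sub>r V = X @\<^sub>r Y @\<^sub>r Z @\<^sub>r W @\<^sub>r V"
  using append_rows_assoc[OF assms(1,2) carrier_append_rows[OF carrier_append_rows[OF assms(3,4)] assms(5)]]
    append_rows_assoc[OF assms(3-5)] by simp

lemma append_rows_zero: "0\<^sub>m a c @\<^sub>r 0\<^sub>m b c = 0\<^sub>m (a + b) c"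
  by (rule eq_matI) (auto simp: append_rows_def)

lemma append_cols_zero: "0\<^sub>m a c @\<^sub>c 0\<^sub>m a e = 0\<^sub>m a (c + e)"
  by (rule eq_matI) (auto simp: append_cols_def)

lemma split_rows:
  assumes "M \<in> carrier_mat (a + b) c"
  obtains X Y where "X \<in> carrier_mat a c" "Y \<in> carrier_mat b c" "M = X @\<^sub>r Y"
proof
  show "mat a c (\<lambda>(i, j). M $$ (i, j)) \<in> carrier_mat a c"
    and "mat b c (\<lambda>(i, j). M $$ (i + a, j)) \<in> carrier_mat b c" by auto
  show "M = mat a c (\<lambda>(i, j). M $$ (i, j)) @\<^sub>r mat b c (\<lambda>(i, j). M $$ (i + a, j))"
    by (rule eq_matI) (use assms in \<open>auto simp: append_rows_def\<close>)
qed

lemma split_cols: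
  assumes "M \<in> carrier_mat a (b + c)"
  obtains X Y where "X \<in> carrier_mat a b" "Y \<in> carrier_mat a c" "M = X @\<^sub>c Y"
proof
  show "mat a b (\<lambda>(i, j). M $$ (i, j)) \<in> carrier_mat a b"
    and "mat a c (\<lambda>(i, j). M $$ (i, j + b)) \<in> carrier_mat a c" by auto
  show "M = mat a b (\<lambda>(i, j). M $$ (i, j)) @\<^sub>c mat a c (\<lambda>(i, j). M $$ (i, j + b))"
    by (rule eq_matI) (use assms in \<open>auto simp: append_cols_def\<close>)
qed

section \<open>Multiplication of stacked and juxtaposed blocks\<close>

lemma four_block_mult_append_rows:
  fixes X :: "real mat"
  assumes "U1 \<in> carrier_mat a k" "U2 \<in> carrier_mat a l"
    and "U3 \<in> carrier_mat b k" "U4 \<in> carrier_mat b l"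
    and "X \<in> carrier_mat k c" "Y \<in> carrier_mat l c"
  shows "four_block_mat U1 U2 U3 U4 * (X @\<^sub>r Y) = (U1 * X + U2 * Y) @\<^sub>r (U3 * X + U4 * Y)"
proof -
  have "four_block_mat U1 U2 U3 U4 * (X @\<^sub>r Y) =
    four_block_mat (U1 * X + U2 * Y) (U1 * 0\<^sub>m k 0 + U2 * 0\<^sub>m l 0)
      (U3 * X + U4 * Y) (U3 * 0\<^sub>m k 0 + U4 * 0\<^sub>m l 0)"
    unfolding append_rows_block[OF assms(5,6)]
    by (rule mult_four_block_mat) (use assms in auto)
  also have "\<dots> = (U1 * X + U2 * Y) @\<^sub>r (U3 * X + U4 * Y)"
    by (subst append_rows_block[of _ a c _ b]) (use assms in auto)
  finally show ?thesis .
qed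

lemma append_rows_mult:
  fixes X :: "real mat"
  assumes "X \<in> carrier_mat a k" "Y \<in> carrier_mat b k" "Q \<in> carrier_mat k c"
  shows "(X @\<^sub>r Y) * Q = X * Q @\<^sub>r Y * Q"
proof (rule eq_matI)
  show "((X @\<^sub>r Y) * Q) $$ (i, j) = (X * Q @\<^sub>r Y * Q) $$ (i, j)"
    if "i < dim_row (X * Q @\<^sub>r Y * Q)" "j < dim_col (X * Q @\<^sub>r Y * Q)" for i j
  proof -
    have i: "i < a + b" and j: "j < c"
      using that assms by (auto simp: append_rows_def)
    have "row (X @\<^sub>r Y) i = (if i < a then row X i else row Y (i - a))"
      by (rule eq_vecI) (use assms i in \<open>auto simp: append_rows_def\<close>)
    then show ?thesis using assms i j
      by (auto simp: append_rows_def)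
  qed
qed (use assms in \<open>auto simp: append_rows_def\<close>)

text \<open>A block row becomes a four-block matrix once a lower block row without rows is added, so
  the product is the upper half of \<open>four_block_mult_append_rows\<close>.\<close>

lemma append_cols_mult_append_rows:
  fixes X :: "real mat"
  assumes "X \<in> carrier_mat a k" "Y \<in> carrier_mat a l" "Z \<in> carrier_mat k c" "W \<in> carrier_mat l c"
  shows "(X @\<^sub>c Y) * (Z @\<^sub>r W) = X * Z + Y * W"
proof -
  have eq: "X @\<^sub>c Y = four_block_mat X Y (0\<^sub>m 0 k) (0\<^sub>m 0 l)"
    using assms by (simp add: append_cols_def)
  have "(X @\<^sub>c Y) * (Z @\<^sub>r W) = (X * Z + Y * W) @\<^sub>r (0\<^sub>m 0 k * Z + 0\<^sub>m 0 l * W)"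
    unfolding eq by (rule four_block_mult_append_rows) (use assms in auto)
  also have "\<dots> = X * Z + Y * W"
    by (rule eq_matI) (use assms in \<open>auto simp: append_rows_def\<close>)
  finally show ?thesis .
qed

lemma mult_append_cols:
  fixes X :: "real mat"
  assumes "M \<in> carrier_mat a k" "X \<in> carrier_mat k b" "Y \<in> carrier_mat k c"
  shows "M * (X @\<^sub>c Y) = M * X @\<^sub>c M * Y"
proof (rule eq_matI)
  show "(M * (X @\<^sub>c Y)) $$ (i, j) = (M * X @\<^sub>c M * Y) $$ (i, j)"
    if "i < dim_row (M * X @\<^sub>c M * Y)" "j < dim_col (M * X @\<^sub>c M * Y)" for i j
  proof -
    have i: "i < a" and j: "j < b + c"
      using that assms by (auto simp: append_cols_def)
    have "col (X @\<^sub>c Y) j = (if j < b then col X j else col Y (j - b))"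
      by (rule eq_vecI) (use assms j in \<open>auto simp: append_cols_def\<close>)
    then show ?thesis using assms i j
      by (auto simp: append_cols_def)
  qed
qed (use assms in \<open>auto simp: append_cols_def\<close>)

lemma add_append_rows:
  fixes X :: "real mat"
  assumes "X \<in> carrier_mat a c" "Y \<in> carrier_mat b c" "X' \<in> carrier_mat a c" "Y' \<in> carrier_mat b c"
  shows "(X @\<^sub>r Y) + (X' @\<^sub>r Y') = (X + X') @\<^sub>r (Y + Y')"
  by (rule eq_matI) (use assms in \<open>auto simp: append_rows_def\<close>)

lemma add_append_cols:
  fixes X :: "real mat"
  assumes "X \<in> carrier_mat a b" "Y \<in> carrier_mat a c" "X' \<in> carrier_mat a b" "Y' \<in> carrier_mat a c"
  shows "(X @\<^sub>c Y) + (X' @\<^sub>c Y') = (X + X') @\<^sub>c (Y + Y')"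
  by (rule eq_matI) (use assms in \<open>auto simp: append_cols_def\<close>)

lemma uminus_r_inv_mat:
  assumes "(M :: real mat) \<in> carrier_mat a b"
  shows "M + - M = 0\<^sub>m a b"
  by (rule eq_matI) (use assms in auto)

subsection \<open>Nonsingular matrices\<close>

lemma nonsingular_carrier: "nonsingular k M \<Longrightarrow> M \<in> carrier_mat k k"
  by (simp add: nonsingular_def)

lemma nonsingularI:
  assumes "M \<in> carrier_mat k k" "N \<in> carrier_mat k k" "M * N = 1\<^sub>m k" "N * M = 1\<^sub>m k"
  shows "nonsingular k M"
  using assms unfolding nonsingular_def invertible_mat_def inverts_mat_def by auto

lemma nonsingularE:
  assumes "nonsingular k M"
  obtains N where "N \<in> carrier_mat k k" "M * N = 1\<^sub>m k" "N * M = 1\<^sub>m k" "nonsingular k N"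
proof -
  have M: "M \<in> carrier_mat k k" using assms by (rule nonsingular_carrier)
  obtain N where N: "M * N = 1\<^sub>m (dim_row M)" "N * M = 1\<^sub>m (dim_row N)"
    using assms unfolding nonsingular_def invertible_mat_def inverts_mat_def by auto
  \<comment> \<open>\<open>invertible_mat\<close> leaves the size of \<open>N\<close> open.
    Comparing the numbers of columns in the two identities forces \<open>N\<close> to be square of
    order \<open>k\<close>.\<close>
  have "dim_col (M * N) = k" "dim_col (N * M) = dim_row N" using N M by auto
  then have "N \<in> carrier_mat k k" using M by auto
  then show thesis using that[of N] N M nonsingularI[of N k M] by auto
qed

lemma nonsingular_one: "nonsingular k (1\<^sub>m k)"
  by (rule nonsingularI[where N = "1\<^sub>m k"]) auto

lemma nonsingular_mult:
  assumes "nonsingular k M" "nonsingular k N"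
  shows "nonsingular k (M * N)"
proof -
  note M = nonsingular_carrier[OF assms(1)] and N = nonsingular_carrier[OF assms(2)]
  obtain M' where M': "M' \<in> carrier_mat k k" "M * M' = 1\<^sub>m k" "M' * M = 1\<^sub>m k"
    using assms(1) by (rule nonsingularE)
  obtain N' where N': "N' \<in> carrier_mat k k" "N * N' = 1\<^sub>m k" "N' * N = 1\<^sub>m k"
    using assms(2) by (rule nonsingularE)
  have "M * N * (N' * M') = M * (N * N') * M'"
    using M N M'(1) N'(1) by (simp add: assoc_mult_mat[of _ k k _ k _ k])
  moreover have "N' * M' * (M * N) = N' * (M' * M) * N"
    using M N M'(1) N'(1) by (simp add: assoc_mult_mat[of _ k k _ k _ k])
  ultimately show ?thesis
    using M N M' N' by (intro nonsingularI[where N = "N' * M'"]) auto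
qed

text \<open>The inverse is again block upper triangular. Its diagonal blocks are the inverses
  \<open>S'\<close> and \<open>T'\<close>, and its corner is \<open>- (S' * L * T')\<close>, which
  makes the corner of both products vanish.\<close>

lemma nonsingular_block_upper:
  assumes "nonsingular a S" "nonsingular b T" and L: "L \<in> carrier_mat a b"
  shows "nonsingular (a + b) (four_block_mat S L (0\<^sub>m b a) T)"
proof -
  note S = nonsingular_carrier[OF assms(1)] and T = nonsingular_carrier[OF assms(2)]
  obtain S' where S': "S' \<in> carrier_mat a a" "S * S' = 1\<^sub>m a" "S' * S = 1\<^sub>m a"
    using assms(1) by (rule nonsingularE)
  obtain T' where T': "T' \<in> carrier_mat b b" "T * T' = 1\<^sub>m b" "T' * T = 1\<^sub>m b"
    using assms(2) by (rule nonsingularE)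
  define L' where "L' = - (S' * L * T')"
  have L': "L' \<in> carrier_mat a b" using S' T' L by (auto simp: L'_def)
  have "S * (S' * L * T') = (S * S') * (L * T')"
    using S S'(1) T'(1) L by (simp add: assoc_mult_mat[of _ a a _ b _ b] assoc_mult_mat[of _ a a _ a _ b])
  then have SL: "S * L' = - (L * T')"
    using S S' T' L by (simp add: L'_def)
  have "S' * L * T' * T = S' * L * (T' * T)"
    using S S'(1) T'(1) T L by (intro assoc_mult_mat[of _ a b _ b _ b]) auto
  then have LT: "L' * T = - (S' * L)"
    using S S' T T' L by (simp add: L'_def)
  have eq1: "S * L' + L * T' = 0\<^sub>m a b" using L T' by (auto simp: SL)
  have eq2: "S' * L + L' * T = 0\<^sub>m a b" using L S' by (auto simp: LT)
  have "four_block_mat S L (0\<^sub>m b a) T * four_block_mat S' L' (0\<^sub>m b a) T' = 1\<^sub>m (a + b)"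
    by (subst mult_four_block_mat) (use S T L S' T' L' eq1 in auto)
  moreover have "four_block_mat S' L' (0\<^sub>m b a) T' * four_block_mat S L (0\<^sub>m b a) T = 1\<^sub>m (a + b)"
    by (subst mult_four_block_mat) (use S T L S' T' L' eq2 in auto)
  ultimately show ?thesis
    using S T S' T' by (intro nonsingularI[where N = "four_block_mat S' L' (0\<^sub>m b a) T'"]) auto
qed

lemma nonsingular_transpose:
  assumes "nonsingular k M"
  shows "nonsingular k M\<^sup>T"
proof -
  obtain N where N: "N \<in> carrier_mat k k" "M * N = 1\<^sub>m k" "N * M = 1\<^sub>m k"
    using assms by (rule nonsingularE)
  note M = nonsingular_carrier[OF assms]
  have "M\<^sup>T * N\<^sup>T = 1\<^sub>m k" "N\<^sup>T * M\<^sup>T = 1\<^sub>m k"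
    using N(2,3) transpose_mult[OF N(1) M] transpose_mult[OF M N(1)] by (metis transpose_one)+
  then show ?thesis using M N(1) by (intro nonsingularI[where N = "N\<^sup>T"]) auto
qed

text \<open>Transposition turns this into the upper triangular case.\<close>

lemma nonsingular_block_lower:
  assumes "nonsingular a S" "nonsingular b T" and "L \<in> carrier_mat b a"
  shows "nonsingular (a + b) (four_block_mat S (0\<^sub>m a b) L T)"
proof -
  have "nonsingular (a + b) (four_block_mat S\<^sup>T L\<^sup>T (0\<^sub>m b a) T\<^sup>T)"
    using assms by (intro nonsingular_block_upper nonsingular_transpose) auto
  then have "nonsingular (a + b) (four_block_mat S\<^sup>T L\<^sup>T (0\<^sub>m b a) T\<^sup>T)\<^sup>T"
    by (rule nonsingular_transpose)
  also have "(four_block_mat S\<^sup>T L\<^sup>T (0\<^sub>m b a) T\<^sup>T)\<^sup>T = four_block_mat S (0\<^sub>m a b) L T"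
    using assms by (subst transpose_four_block_mat[of _ a a _ b]) (auto dest: nonsingular_carrier)
  finally show ?thesis .
qed

lemma nonsingular_diag:
  assumes "nonsingular a S" "nonsingular b T"
  shows "nonsingular (a + b) (four_block_mat S (0\<^sub>m a b) (0\<^sub>m b a) T)"
  using assms by (rule nonsingular_block_upper) simp

section \<open>Permutations of two blocks\<close>

text \<open>A permutation matrix. Multiplied from the left, it exchanges an upper block of
  \<open>a\<close> rows with a lower block of \<open>b\<close> rows, and its inverse has the two
  sizes exchanged.\<close>

definition block_swap :: "nat \<Rightarrow> nat \<Rightarrow> real mat" where
  "block_swap a b = four_block_mat (0\<^sub>m b a) (1\<^sub>m b) (1\<^sub>m a) (0\<^sub>m a b)"

lemma block_swap_carrier: "block_swap a b \<in> carrier_mat (a + b) (a + b)"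
  by (auto simp: block_swap_def)

lemma block_swap_inverse: "block_swap a b * block_swap b a = 1\<^sub>m (a + b)"
  unfolding block_swap_def by (subst mult_four_block_mat) (auto simp: add.commute)

lemma nonsingular_block_swap: "nonsingular (a + b) (block_swap a b)"
  using block_swap_carrier[of a b] block_swap_carrier[of b a] block_swap_inverse[of a b]
    block_swap_inverse[of b a]
  by (intro nonsingularI[where N = "block_swap b a"]) (auto simp: add.commute)

lemma block_swap_mult:
  assumes "X \<in> carrier_mat a c" "Y \<in> carrier_mat b c"
  shows "block_swap a b * (X @\<^sub>r Y) = Y @\<^sub>r X"
  unfolding block_swap_def
  by (subst four_block_mult_append_rows[OF _ _ _ _ assms]) (use assms in auto)

subsection \<open>Rank normal form and row compression\<close>

text \<open>Each vector \<open>y\<close> is the image of \<open>X *\<^sub>v y\<close>, so the column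
  space is the whole space and its dimension is the number of rows.\<close>

lemma full_row_rankI_right_inverse:
  assumes M: "M \<in> carrier_mat r d" and X: "X \<in> carrier_mat d r" and MX: "M * X = 1\<^sub>m r"
  shows "full_row_rank M"
proof -
  interpret vec_space "TYPE(real)" r .
  have "col_space M = carrier_vec r"
  proof
    show "col_space M \<subseteq> carrier_vec r"
      using M by (auto simp: col_space_eq[OF M])
    show "carrier_vec r \<subseteq> col_space M"
    proof
      fix y :: "real vec"
      assume y: "y \<in> carrier_vec r"
      have "M *\<^sub>v (X *\<^sub>v y) = (M * X) *\<^sub>v y"
        using M X y by (intro assoc_mult_mat_vec[symmetric]) auto
      then have "M *\<^sub>v (X *\<^sub>v y) = y" using y by (simp add: MX)
      moreover have "X *\<^sub>v y \<in> carrier_vec d" using X y by auto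
      ultimately show "y \<in> col_space M"
        using M y by (auto simp: col_space_eq[OF M])
    qed
  qed
  then have "rank M = dim"
    unfolding rank_def col_space_def by (simp add: module_vec_def)
  then show ?thesis using M dim_is_n by (simp add: full_row_rank_def)
qed

section \<open>Reduction to the rank normal form by elimination\<close>

text \<open>For \<open>r\<close> at most \<open>m\<close> and \<open>d\<close> this is the
  representative of the rank \<open>r\<close> matrices under multiplication by nonsingular matrices
  on both sides. Keeping \<open>r\<close> apart from the two sizes also covers the rectangular
  identities \<open>partial_identity r r d\<close> and
  \<open>partial_identity r d r\<close>.\<close>

definition partial_identity :: "nat \<Rightarrow> nat \<Rightarrow> nat \<Rightarrow> real mat" where
  "partial_identity r m d = mat m d (\<lambda>(i, j). if i = j \<and> i < r then 1 else 0)"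

lemma partial_identity_carrier [simp]: "partial_identity r m d \<in> carrier_mat m d"
  by (simp add: partial_identity_def)

lemma partial_identity_append_rows:
  assumes "r \<le> m"
  shows "partial_identity r m d = partial_identity r r d @\<^sub>r 0\<^sub>m (m - r) d"
  by (rule eq_matI) (use assms in \<open>auto simp: partial_identity_def append_rows_def\<close>)

lemma partial_identity_append_cols:
  assumes "r \<le> d"
  shows "partial_identity r r d = 1\<^sub>m r @\<^sub>c 0\<^sub>m r (d - r)"
  by (rule eq_matI) (use assms in \<open>auto simp: partial_identity_def append_cols_def\<close>)

lemma partial_identity_right_inverse:
  assumes "r \<le> d"
  shows "partial_identity r r d * partial_identity r d r = 1\<^sub>m r"
proof -
  have "(1\<^sub>m r @\<^sub>c 0\<^sub>m r (d - r)) * (1\<^sub>m r @\<^sub>r 0\<^sub>m (d - r) r) = 1\<^sub>m r"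
    by (subst append_cols_mult_append_rows) auto
  moreover have "partial_identity r d r = 1\<^sub>m r @\<^sub>r 0\<^sub>m (d - r) r"
    by (rule eq_matI) (use assms in \<open>auto simp: partial_identity_def append_rows_def\<close>)
  ultimately show ?thesis using partial_identity_append_cols[OF assms] by simp
qed

lemma partial_identity_Suc:
  "four_block_mat (1\<^sub>m 1) (0\<^sub>m 1 d) (0\<^sub>m m 1) (partial_identity r m d) =
   partial_identity (Suc r) (Suc m) (Suc d)"
  by (rule eq_matI) (auto simp: partial_identity_def)

lemma nonsingular_swaprows_mat:
  assumes "k < n" "l < n"
  shows "nonsingular n (swaprows_mat n k l)"
  using swaprows_mat_inv[OF assms] by (intro nonsingularI[where N = "swaprows_mat n k l"]) auto

lemma move_to_corner:
  assumes M: "(M :: real mat) \<in> carrier_mat m d" and ij: "i < m" "j < d"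
  obtains P Q where "nonsingular m P" "nonsingular d Q" "(P * M * Q) $$ (0, 0) = M $$ (i, j)"
proof
  let ?P = "swaprows_mat m 0 i :: real mat" and ?Q = "swaprows_mat d 0 j :: real mat"
  show "nonsingular m ?P" "nonsingular d ?Q"
    using ij by (auto intro!: nonsingular_swaprows_mat)
  have "?P * M * ?Q = swapcols 0 j (swaprows 0 i M)"
    using M ij by (subst swapcols_mat[of _ m d]) (auto simp: swaprows_mat[symmetric, OF M])
  then show "(?P * M * ?Q) $$ (0, 0) = M $$ (i, j)"
    using M ij by auto
qed

text \<open>One elimination step with pivot \<open>M $$ (0, 0)\<close>. The row operation scales the
  pivot to 1 and clears the column below it, then the column operation clears the rest of the first
  row. The remaining block \<open>N\<close> is the Schur complement of the pivot.\<close>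

lemma clear_corner:
  assumes M: "(M :: real mat) \<in> carrier_mat (Suc m) (Suc d)" and nz: "M $$ (0, 0) \<noteq> 0"
  obtains P Q N where "nonsingular (Suc m) P" "nonsingular (Suc d) Q" "N \<in> carrier_mat m d"
    "P * M * Q = four_block_mat (1\<^sub>m 1) (0\<^sub>m 1 d) (0\<^sub>m m 1) N"
proof -
  obtain Ma Mb Mc Md where split: "split_block M 1 1 = (Ma, Mb, Mc, Md)"
    by (cases "split_block M 1 1")
  have Ma: "Ma \<in> carrier_mat 1 1" and Mb: "Mb \<in> carrier_mat 1 d"
    and Mc: "Mc \<in> carrier_mat m 1" and Md: "Md \<in> carrier_mat m d"
    and M_eq: "M = four_block_mat Ma Mb Mc Md"
    using split_block[OF split, of m d] M by auto
  define b where "b = M $$ (0, 0)"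
  have Ma_eq: "Ma = mat 1 1 (\<lambda>_. b)"
    using Ma by (intro eq_matI) (auto simp: b_def M_eq)
  define Ia where "Ia = mat 1 1 (\<lambda>_. 1 / b)"
  have b: "b \<noteq> 0" using nz by (simp add: b_def)
  have inv: "Ia * Ma = 1\<^sub>m 1" "Ma * Ia = 1\<^sub>m 1"
    using b by (auto simp: Ma_eq Ia_def scalar_prod_def intro!: eq_matI)
  have Ia: "Ia \<in> carrier_mat 1 1" by (simp add: Ia_def)
  define L where "L = - (Mc * Ia)"
  define R where "R = - (Ia * Mb)"
  define N where "N = L * Mb + Md"
  have L: "L \<in> carrier_mat m 1" and R: "R \<in> carrier_mat 1 d" and N: "N \<in> carrier_mat m d"
    using Mc Mb Md Ia by (auto simp: L_def R_def N_def)
  have "Mc * Ia * Ma = Mc * (Ia * Ma)"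
    using Mc Ia Ma by (rule assoc_mult_mat)
  then have LMa: "L * Ma + Mc = 0\<^sub>m m 1"
    using Mc Ia Ma inv(1) by (simp add: L_def)
  have nP: "nonsingular (Suc m) (four_block_mat Ia (0\<^sub>m 1 m) L (1\<^sub>m m))"
    using nonsingular_block_lower[OF nonsingularI[OF Ia Ma inv] nonsingular_one L] by simp
  have nQ: "nonsingular (Suc d) (four_block_mat (1\<^sub>m 1) R (0\<^sub>m d 1) (1\<^sub>m d))"
    using nonsingular_block_upper[OF nonsingular_one nonsingular_one R] by simp
  have "four_block_mat Ia (0\<^sub>m 1 m) L (1\<^sub>m m) * M = four_block_mat (1\<^sub>m 1) (Ia * Mb) (0\<^sub>m m 1) N"
    unfolding M_eq by (subst mult_four_block_mat) (use Ia Ma Mb Mc Md L LMa inv in \<open>auto simp: N_def\<close>)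
  moreover have "four_block_mat (1\<^sub>m 1) (Ia * Mb) (0\<^sub>m m 1) N
      * four_block_mat (1\<^sub>m 1) R (0\<^sub>m d 1) (1\<^sub>m d)
    = four_block_mat (1\<^sub>m 1) (0\<^sub>m 1 d) (0\<^sub>m m 1) N"
    by (subst mult_four_block_mat) (use Ia Mb R N in \<open>auto simp: R_def\<close>)
  ultimately show thesis using that[OF nP nQ N] by simp
qed

text \<open>Induction on the number of rows: a nonzero entry is moved to the corner, its row and
  column are cleared, and the induction hypothesis handles the remaining block. That block has one
  column less as well, so \<open>d\<close> varies in the induction.\<close>

lemma rank_normal_form:
  assumes "(M :: real mat) \<in> carrier_mat m d"
  shows "\<exists>r P Q. r \<le> m \<and> r \<le> d \<and> nonsingular m P \<and> nonsingular d Q \<and>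
    P * M * Q = partial_identity r m d"
  using assms
proof (induction m arbitrary: d M)
  case 0
  then have "1\<^sub>m 0 * M * 1\<^sub>m d = partial_identity 0 0 d"
    by (intro eq_matI) (auto simp: partial_identity_def)
  then show ?case using nonsingular_one by blast
next
  case (Suc m)
  show ?case
  proof (cases "M = 0\<^sub>m (Suc m) d")
    case True
    then have "1\<^sub>m (Suc m) * M * 1\<^sub>m d = partial_identity 0 (Suc m) d"
      by (intro eq_matI) (auto simp: partial_identity_def)
    then show ?thesis using nonsingular_one by blast
  next
    case False
    then obtain i j where ij: "i < Suc m" "j < d" "M $$ (i, j) \<noteq> 0"
      using Suc.prems by (metis carrier_matD eq_matI index_zero_mat)
    obtain e where d: "d = Suc e" using ij by (cases d) auto
    obtain P1 Q1 where 1: "nonsingular (Suc m) P1" "nonsingular d Q1" "(P1 * M * Q1) $$ (0, 0) \<noteq> 0"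
      using move_to_corner[OF Suc.prems ij(1,2)] ij(3) by metis
    note c1 = nonsingular_carrier[OF 1(1)] nonsingular_carrier[OF 1(2)]
    have "P1 * M * Q1 \<in> carrier_mat (Suc m) (Suc e)" using c1 Suc.prems d by auto
    then obtain P2 Q2 N where 2: "nonsingular (Suc m) P2" "nonsingular d Q2" "N \<in> carrier_mat m e"
      and N: "P2 * (P1 * M * Q1) * Q2 = four_block_mat (1\<^sub>m 1) (0\<^sub>m 1 e) (0\<^sub>m m 1) N"
      using clear_corner[OF _ 1(3)] d by metis
    obtain r P3 Q3 where 3: "r \<le> m" "r \<le> e" "nonsingular m P3" "nonsingular e Q3"
      and PNQ: "P3 * N * Q3 = partial_identity r m e"
      using Suc.IH[OF 2(3)] by blast
    \<comment> \<open>The transformations of the smaller block are bordered by 1, which leaves the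
      cleared pivot row and column in place.\<close>
    define P4 where "P4 = four_block_mat (1\<^sub>m 1) (0\<^sub>m 1 m) (0\<^sub>m m 1) P3"
    define Q4 where "Q4 = four_block_mat (1\<^sub>m 1) (0\<^sub>m 1 e) (0\<^sub>m e 1) Q3"
    have 4: "nonsingular (Suc m) P4" "nonsingular d Q4"
      using nonsingular_diag[OF nonsingular_one[of 1] 3(3)] nonsingular_diag[OF nonsingular_one[of 1] 3(4)]
      by (simp_all add: P4_def Q4_def d)
    note c2 = nonsingular_carrier[OF 2(1)] nonsingular_carrier[OF 2(2)]
    note c3 = nonsingular_carrier[OF 3(3)] nonsingular_carrier[OF 3(4)]
    note c4 = nonsingular_carrier[OF 4(1)] nonsingular_carrier[OF 4(2)]
    have "P4 * four_block_mat (1\<^sub>m 1) (0\<^sub>m 1 e) (0\<^sub>m m 1) N * Q4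
      = four_block_mat (1\<^sub>m 1) (0\<^sub>m 1 e) (0\<^sub>m m 1) (P3 * N) * Q4"
      unfolding P4_def by (subst mult_four_block_mat) (use c3 2(3) in auto)
    also have "\<dots> = four_block_mat (1\<^sub>m 1) (0\<^sub>m 1 e) (0\<^sub>m m 1) (P3 * N * Q3)"
      unfolding Q4_def by (subst mult_four_block_mat) (use c3 2(3) in auto)
    also have "\<dots> = partial_identity (Suc r) (Suc m) d"
      by (simp only: PNQ partial_identity_Suc d)
    finally have "P4 * (P2 * (P1 * M * Q1) * Q2) * Q4 = partial_identity (Suc r) (Suc m) d"
      by (simp only: N)
    moreover have "P4 * (P2 * (P1 * M * Q1) * Q2) * Q4 = (P4 * (P2 * P1)) * M * (Q1 * (Q2 * Q4))"
      using c1 c2 c4 Suc.prems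
      by (simp add: assoc_mult_mat[of _ "Suc m" "Suc m" _ "Suc m" _ "Suc m"]
          assoc_mult_mat[of _ "Suc m" "Suc m" _ "Suc m" _ d]
          assoc_mult_mat[of _ "Suc m" "Suc m" _ d _ d]
          assoc_mult_mat[of _ "Suc m" d _ d _ d] assoc_mult_mat[of _ d d _ d _ d])
    moreover have "nonsingular (Suc m) (P4 * (P2 * P1))" "nonsingular d (Q1 * (Q2 * Q4))"
      using 1 2 4 by (auto intro!: nonsingular_mult)
    ultimately show ?thesis using 3(1,2) d by (metis Suc_le_mono)
  qed
qed

text \<open>Moving the column transformation of the rank normal form to the other side gives
  \<open>P * M = partial_identity r m d * Q'\<close>. The rows below the first \<open>r\<close> are
  zero, and the first \<open>r\<close> rows are those of the invertible matrix
  \<open>Q'\<close>.\<close>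

lemma row_compression:
  assumes M: "(M :: real mat) \<in> carrier_mat m d"
  obtains r U M1 where "r \<le> m" "nonsingular m U" "M1 \<in> carrier_mat r d" "full_row_rank M1"
    "U * M = M1 @\<^sub>r 0\<^sub>m (m - r) d"
proof -
  obtain r P Q where r: "r \<le> m" "r \<le> d" and P: "nonsingular m P" and Q: "nonsingular d Q"
    and nf: "P * M * Q = partial_identity r m d"
    using rank_normal_form[OF M] by blast
  obtain Q' where Q': "Q' \<in> carrier_mat d d" "Q * Q' = 1\<^sub>m d" "Q' * Q = 1\<^sub>m d"
    using Q by (rule nonsingularE)
  note cP = nonsingular_carrier[OF P] and cQ = nonsingular_carrier[OF Q]
  define M1 where "M1 = partial_identity r r d * Q'"
  have M1: "M1 \<in> carrier_mat r d" unfolding M1_def using Q'(1) by (rule mult_carrier_mat[OF partial_identity_carrier])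
  have "P * M = P * M * (Q * Q')" using cP M Q' by simp
  also have "\<dots> = P * M * Q * Q'"
    using cP cQ M Q'(1) by (intro assoc_mult_mat[symmetric]) auto
  also have "\<dots> = M1 @\<^sub>r 0\<^sub>m (m - r) d"
    unfolding nf partial_identity_append_rows[OF r(1)] M1_def
    by (subst append_rows_mult[OF partial_identity_carrier _ Q'(1)]) (use Q'(1) in auto)
  finally have PM: "P * M = M1 @\<^sub>r 0\<^sub>m (m - r) d" .
  \<comment> \<open>The first \<open>r\<close> columns of \<open>Q\<close> form a right inverse of
    the first \<open>r\<close> rows of \<open>Q'\<close>, which certifies full row rank.\<close>
  have "M1 * (Q * partial_identity r d r) = partial_identity r r d * (Q' * Q) * partial_identity r d r"
    using cQ Q'(1) unfolding M1_def
    by (simp add: assoc_mult_mat[of _ r d _ d _ r] assoc_mult_mat[of _ d d _ d _ r]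
        assoc_mult_mat[of _ r d _ d _ d])
  also have "\<dots> = 1\<^sub>m r"
    using r by (simp add: Q'(3) partial_identity_right_inverse right_mult_one_mat[of _ r d])
  finally have "full_row_rank M1"
    using cQ by (intro full_row_rankI_right_inverse[OF M1, of "Q * partial_identity r d r"]) auto
  then show thesis using that r P M1 PM by blast
qed

text \<open>The rank normal form with its blocks permuted so that the identity stands at the lower
  right. The rows without input then come first, and the \<open>p - k\<close> columns that act on
  nothing come first too, where the condensed form has the part \<open>v\<^sub>1\<close>.\<close>

lemma input_normal_form:
  assumes M: "(M :: real mat) \<in> carrier_mat m p"
  obtains k P Q where "k \<le> m" "k \<le> p" "nonsingular m P" "nonsingular p Q"
    "P * M * Q = 0\<^sub>m (m - k) p @\<^sub>r (0\<^sub>m k (p - k) @\<^sub>c 1\<^sub>m k)"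
proof -
  obtain k P Q where k: "k \<le> m" "k \<le> p" and P: "nonsingular m P" and Q: "nonsingular p Q"
    and nf: "P * M * Q = partial_identity k m p"
    using rank_normal_form[OF M] by blast
  let ?S = "block_swap k (m - k)" and ?T = "block_swap (p - k) k"
  note cP = nonsingular_carrier[OF P] and cQ = nonsingular_carrier[OF Q]
  have cS: "?S \<in> carrier_mat m m" and cT: "?T \<in> carrier_mat p p"
    using block_swap_carrier[of k "m - k"] block_swap_carrier[of "p - k" k] k by auto
  \<comment> \<open>As a factor on the right, \<open>?T\<close> matters through its upper
    \<open>k\<close> rows, which are picked out by \<open>partial_identity k k p\<close> and have
    the desired shape, zeros followed by the identity.\<close>
  have T_eq: "?T = (0\<^sub>m k (p - k) @\<^sub>c 1\<^sub>m k) @\<^sub>r (1\<^sub>m (p - k) @\<^sub>c 0\<^sub>m (p - k) k)"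
    by (rule eq_matI) (auto simp: block_swap_def append_rows_def append_cols_def)
  have kp: "p = p - k + k" using k by simp
  have cI: "0\<^sub>m k (p - k) @\<^sub>c 1\<^sub>m k \<in> carrier_mat k p"
    using append_cols_carrier[of "0\<^sub>m k (p - k)" k "p - k" "1\<^sub>m k" k] kp by simp
  have cI': "1\<^sub>m (p - k) @\<^sub>c 0\<^sub>m (p - k) k \<in> carrier_mat (p - k) p"
    using append_cols_carrier[of "1\<^sub>m (p - k)" "p - k" "p - k" "0\<^sub>m (p - k) k" k] kp by simp
  have "partial_identity k k p * ?T = 0\<^sub>m k (p - k) @\<^sub>c 1\<^sub>m k"
    unfolding partial_identity_append_cols[OF k(2)] T_eq
    by (subst append_cols_mult_append_rows[OF _ _ cI cI']) (use cI cI' in auto)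
  moreover have "?S * partial_identity k m p = 0\<^sub>m (m - k) p @\<^sub>r partial_identity k k p"
    unfolding partial_identity_append_rows[OF k(1)]
    by (rule block_swap_mult) auto
  ultimately have "?S * partial_identity k m p * ?T = 0\<^sub>m (m - k) p @\<^sub>r (0\<^sub>m k (p - k) @\<^sub>c 1\<^sub>m k)"
    using append_rows_mult[of "0\<^sub>m (m - k) p" "m - k" p "partial_identity k k p" k ?T p] cT by simp
  moreover have "(?S * P) * M * (Q * ?T) = ?S * (P * M * Q) * ?T"
    using cP cQ cS cT M
    by (simp add: assoc_mult_mat[of _ m m _ m _ p] assoc_mult_mat[of _ m m _ p _ p]
        assoc_mult_mat[of _ m p _ p _ p])
  moreover have "nonsingular m (?S * P)" "nonsingular p (Q * ?T)"
    using P Q nonsingular_block_swap[of k "m - k"] nonsingular_block_swap[of "p - k" k] k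
    by (auto intro!: nonsingular_mult)
  ultimately show thesis using that[OF k] nf by simp
qed

subsection \<open>The condensed form at a single time\<close>

lemma diag_mult_append_rows:
  fixes X :: "real mat"
  assumes "S \<in> carrier_mat a a" "T \<in> carrier_mat b b"
    and "X \<in> carrier_mat a c" "Y \<in> carrier_mat b c"
  shows "four_block_mat S (0\<^sub>m a b) (0\<^sub>m b a) T * (X @\<^sub>r Y) = S * X @\<^sub>r T * Y"
  by (subst four_block_mult_append_rows[OF assms(1) _ _ assms(2) assms(3) assms(4)]) (use assms in auto)

lemma append_cols_mult_diag:
  fixes X :: "real mat"
  assumes "X \<in> carrier_mat k a" "Y \<in> carrier_mat k b"
    and "S \<in> carrier_mat a a" "T \<in> carrier_mat b b"
  shows "(X @\<^sub>c Y) * four_block_mat S (0\<^sub>m a b) (0\<^sub>m b a) T = X * S @\<^sub>c Y * T"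
proof -
  have eq: "X @\<^sub>c Y = four_block_mat X Y (0\<^sub>m 0 a) (0\<^sub>m 0 b)"
    using assms by (simp add: append_cols_def)
  have eq': "X * S @\<^sub>c Y * T = four_block_mat (X * S) (Y * T) (0\<^sub>m 0 a) (0\<^sub>m 0 b)"
    using assms by (simp add: append_cols_def)
  show ?thesis unfolding eq eq'
    by (subst mult_four_block_mat[of _ k a _ b _ 0]) (use assms in auto)
qed

text \<open>A single \<open>R\<close> serves all stacks with these block heights, whatever their
  number of columns. The same row permutation can therefore act on the state coefficients with
  \<open>d\<close> columns and on the input matrix with \<open>p\<close> columns.\<close>

lemma swap_last_rows:
  obtains R where "nonsingular (a + b + e) R"
    "\<And>X Y Z c. \<lbrakk>X \<in> carrier_mat a c; Y \<in> carrier_mat b c; Z \<in> carrier_mat e c\<rbrakk> \<Longrightarrow>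
      R * ((X @\<^sub>r Y) @\<^sub>r Z) = X @\<^sub>r Z @\<^sub>r Y"
proof
  let ?R = "four_block_mat (1\<^sub>m a) (0\<^sub>m a (b + e)) (0\<^sub>m (b + e) a) (block_swap b e)"
  show "nonsingular (a + b + e) ?R"
    using nonsingular_diag[OF nonsingular_one nonsingular_block_swap] by (simp add: add.assoc)
  show "?R * ((X @\<^sub>r Y) @\<^sub>r Z) = X @\<^sub>r Z @\<^sub>r Y"
    if "X \<in> carrier_mat a c" "Y \<in> carrier_mat b c" "Z \<in> carrier_mat e c" for X Y Z :: "real mat" and c
    unfolding append_rows_assoc[OF that]
    by (subst diag_mult_append_rows[OF _ block_swap_carrier])
      (use that in \<open>auto simp: block_swap_mult\<close>)
qed

text \<open>First the rows of \<open>B\<close> are compressed, then those of \<open>C\<close> where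
  the transformed \<open>B\<close> vanishes. The second compression keeps the shape of
  \<open>B\<close>, because it only mixes rows in which \<open>B\<close> is already zero. The
  \<open>v\<close> zero rows are bracketed separately, ready to be moved to the bottom
  later.\<close>

lemma uncontrolled_rows:
  assumes B: "(B :: real mat) \<in> carrier_mat m d" and C: "C \<in> carrier_mat m d"
  obtains r1 r0 v U B2 C2 C3 where "r1 + r0 + v = m" "nonsingular m U"
    "B2 \<in> carrier_mat r1 d" "C2 \<in> carrier_mat r1 d" "C3 \<in> carrier_mat r0 d"
    "full_row_rank B2" "full_row_rank C3"
    "U * B = (B2 @\<^sub>r 0\<^sub>m r0 d) @\<^sub>r 0\<^sub>m v d" "U * C = (C2 @\<^sub>r C3) @\<^sub>r 0\<^sub>m v d"
proof -
  obtain r1 U1 B2 where r1: "r1 \<le> m" and U1: "nonsingular m U1"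
    and B2: "B2 \<in> carrier_mat r1 d" "full_row_rank B2" and U1B: "U1 * B = B2 @\<^sub>r 0\<^sub>m (m - r1) d"
    using row_compression[OF B] by metis
  note cU1 = nonsingular_carrier[OF U1]
  have "U1 * C \<in> carrier_mat (r1 + (m - r1)) d" using cU1 C r1 by auto
  then obtain C2 C' where C2: "C2 \<in> carrier_mat r1 d" and C': "C' \<in> carrier_mat (m - r1) d"
    and U1C: "U1 * C = C2 @\<^sub>r C'"
    by (rule split_rows)
  obtain r0 U2 C3 where r0: "r0 \<le> m - r1" and U2: "nonsingular (m - r1) U2"
    and C3: "C3 \<in> carrier_mat r0 d" "full_row_rank C3" and U2C: "U2 * C' = C3 @\<^sub>r 0\<^sub>m (m - r1 - r0) d"
    using row_compression[OF C'] by metis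
  note cU2 = nonsingular_carrier[OF U2]
  define v where "v = m - r1 - r0"
  have m: "m - r1 = r0 + v" using r0 by (simp add: v_def)
  define G where "G = four_block_mat (1\<^sub>m r1) (0\<^sub>m r1 (m - r1)) (0\<^sub>m (m - r1) r1) U2"
  have G: "nonsingular m G"
    using nonsingular_diag[OF nonsingular_one[of r1] U2] r1 by (simp add: G_def)
  note cG = nonsingular_carrier[OF G]
  have "G * U1 * B = G * (B2 @\<^sub>r 0\<^sub>m (m - r1) d)"
    using cG cU1 B by (simp add: U1B[symmetric])
  also have "\<dots> = B2 @\<^sub>r 0\<^sub>m r0 d @\<^sub>r 0\<^sub>m v d"
    unfolding G_def by (subst diag_mult_append_rows[OF _ cU2])
      (use B2 cU2 in \<open>auto simp: append_rows_zero m\<close>)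
  also have "\<dots> = (B2 @\<^sub>r 0\<^sub>m r0 d) @\<^sub>r 0\<^sub>m v d"
    using B2 by (subst append_rows_assoc) auto
  finally have GB: "G * U1 * B = (B2 @\<^sub>r 0\<^sub>m r0 d) @\<^sub>r 0\<^sub>m v d" .
  have "G * U1 * C = G * (C2 @\<^sub>r C')"
    using cG cU1 C by (simp add: U1C[symmetric])
  also have "\<dots> = C2 @\<^sub>r C3 @\<^sub>r 0\<^sub>m v d"
    unfolding G_def by (subst diag_mult_append_rows[OF _ cU2 C2 C'])
      (use C2 in \<open>auto simp: U2C v_def\<close>)
  also have "\<dots> = (C2 @\<^sub>r C3) @\<^sub>r 0\<^sub>m v d"
    using C2 C3 by (subst append_rows_assoc) auto
  finally have GC: "G * U1 * C = (C2 @\<^sub>r C3) @\<^sub>r 0\<^sub>m v d" .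
  have "r1 + r0 + v = m" using r1 r0 by (simp add: v_def)
  then show thesis
    using that[OF _ nonsingular_mult[OF G U1] B2(1) C2 C3(1) B2(2) C3(2) GB GC] by simp
qed

text \<open>After normalization of the input, the rows without input (upper part, transformed by
  \<open>S\<close>) and the rows with input (lower part, transformed by \<open>T\<close>) are
  treated independently. It then remains to repair the input columns and to move the zero rows to
  the end.\<close>

lemma condense_below_leading_block:
  assumes B: "(B :: real mat) \<in> carrier_mat m d" and C: "C \<in> carrier_mat m d"
    and D: "D \<in> carrier_mat m p"
  obtains r1 r0 k1 k0 v q U V B2 B4 C2 C3 C4 C5 where
    "r1 + r0 + k1 + k0 + v = m" "q + k1 + k0 = p" "nonsingular m U" "nonsingular p V"
    "B2 \<in> carrier_mat r1 d" "C2 \<in> carrier_mat r1 d" "C3 \<in> carrier_mat r0 d"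
    "B4 \<in> carrier_mat k1 d" "C4 \<in> carrier_mat k1 d" "C5 \<in> carrier_mat k0 d"
    "full_row_rank B2" "full_row_rank C3" "full_row_rank B4"
    "U * B = B2 @\<^sub>r 0\<^sub>m r0 d @\<^sub>r B4 @\<^sub>r 0\<^sub>m k0 d @\<^sub>r 0\<^sub>m v d"
    "U * C = C2 @\<^sub>r C3 @\<^sub>r C4 @\<^sub>r C5 @\<^sub>r 0\<^sub>m v d"
    "U * D * V = 0\<^sub>m r1 p @\<^sub>r 0\<^sub>m r0 p @\<^sub>r (0\<^sub>m k1 q @\<^sub>c 1\<^sub>m k1 @\<^sub>c 0\<^sub>m k1 k0) @\<^sub>r
      (0\<^sub>m k0 q @\<^sub>c 0\<^sub>m k0 k1 @\<^sub>c 1\<^sub>m k0) @\<^sub>r 0\<^sub>m v p"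
proof -
  obtain k P Q where k: "k \<le> m" "k \<le> p" and P: "nonsingular m P" and Q: "nonsingular p Q"
    and PDQ: "P * D * Q = 0\<^sub>m (m - k) p @\<^sub>r (0\<^sub>m k (p - k) @\<^sub>c 1\<^sub>m k)"
    using input_normal_form[OF D] by metis
  note cP = nonsingular_carrier[OF P] and cQ = nonsingular_carrier[OF Q]
  have "P * B \<in> carrier_mat ((m - k) + k) d" using cP B k by auto
  then obtain Bb Bt where Bb: "Bb \<in> carrier_mat (m - k) d" and Bt: "Bt \<in> carrier_mat k d"
    and PB: "P * B = Bb @\<^sub>r Bt" by (rule split_rows)
  have "P * C \<in> carrier_mat ((m - k) + k) d" using cP C k by auto
  then obtain Cb Ct where Cb: "Cb \<in> carrier_mat (m - k) d" and Ct: "Ct \<in> carrier_mat k d"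
    and PC: "P * C = Cb @\<^sub>r Ct" by (rule split_rows)
  obtain r1 r0 v S B2 C2 C3 where sizes: "r1 + r0 + v = m - k" and S: "nonsingular (m - k) S"
    and B2: "B2 \<in> carrier_mat r1 d" and C2: "C2 \<in> carrier_mat r1 d" and C3: "C3 \<in> carrier_mat r0 d"
    and rank: "full_row_rank B2" "full_row_rank C3"
    and SB: "S * Bb = (B2 @\<^sub>r 0\<^sub>m r0 d) @\<^sub>r 0\<^sub>m v d" and SC: "S * Cb = (C2 @\<^sub>r C3) @\<^sub>r 0\<^sub>m v d"
    using uncontrolled_rows[OF Bb Cb] by metis
  obtain k1 T B4 where k1: "k1 \<le> k" and T: "nonsingular k T"
    and B4: "B4 \<in> carrier_mat k1 d" "full_row_rank B4" and TB: "T * Bt = B4 @\<^sub>r 0\<^sub>m (k - k1) d"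
    using row_compression[OF Bt] by metis
  obtain T' where T': "T' \<in> carrier_mat k k" "T * T' = 1\<^sub>m k" and nT': "nonsingular k T'"
    using T by (rule nonsingularE)
  note cS = nonsingular_carrier[OF S] and cT = nonsingular_carrier[OF T]
  define k0 where "k0 = k - k1"
  define q where "q = p - k"
  have k_eq: "k = k1 + k0" using k1 by (simp add: k0_def)
  have p_eq: "q + k = p" using k by (simp add: q_def)
  have m_eq: "m - k = r1 + r0 + v" "r1 + r0 + v + k = m" using sizes k by auto
  have "T * Ct \<in> carrier_mat (k1 + k0) d" using cT Ct k_eq by auto
  then obtain C4 C5 where C4: "C4 \<in> carrier_mat k1 d" and C5: "C5 \<in> carrier_mat k0 d"
    and TC: "T * Ct = C4 @\<^sub>r C5" by (rule split_rows)
  define G where "G = four_block_mat S (0\<^sub>m (m - k) k) (0\<^sub>m k (m - k)) T"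
  have G: "nonsingular m G" using nonsingular_diag[OF S T] k by (simp add: G_def)
  \<comment> \<open>\<open>G\<close> turns the identity in the input matrix into \<open>T\<close>.
    \<open>H\<close> multiplies the same columns by the inverse \<open>T'\<close> and restores the
    identity.\<close>
  define H where "H = four_block_mat (1\<^sub>m q) (0\<^sub>m q k) (0\<^sub>m k q) T'"
  have H: "nonsingular p H" using nonsingular_diag[OF nonsingular_one nT', of q] p_eq by (simp add: H_def)
  \<comment> \<open>The \<open>v\<close> zero rows still stand between the two groups;
    \<open>R\<close> exchanges them with the \<open>k\<close> rows with input.\<close>
  obtain R where R: "nonsingular m R"
    and swap: "\<And>X Y Z c. \<lbrakk>X \<in> carrier_mat (r1 + r0) c; Y \<in> carrier_mat v c; Z \<in> carrier_mat k c\<rbrakk> \<Longrightarrow>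
      R * ((X @\<^sub>r Y) @\<^sub>r Z) = X @\<^sub>r Z @\<^sub>r Y"
    using swap_last_rows[of "r1 + r0" v k] m_eq(2) by metis
  note cG = nonsingular_carrier[OF G] and cH = nonsingular_carrier[OF H]
    and cR = nonsingular_carrier[OF R]
  define U where "U = R * (G * P)"
  define V where "V = Q * H"
  have U: "nonsingular m U" and V: "nonsingular p V"
    using R G P Q H by (auto simp: U_def V_def intro!: nonsingular_mult)
  have "U * B = R * (G * (Bb @\<^sub>r Bt))"
    using cR cG cP B
    by (simp add: U_def PB[symmetric] assoc_mult_mat[of _ m m _ m _ d])
  also have "G * (Bb @\<^sub>r Bt) = ((B2 @\<^sub>r 0\<^sub>m r0 d) @\<^sub>r 0\<^sub>m v d) @\<^sub>r (B4 @\<^sub>r 0\<^sub>m k0 d)"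
    unfolding G_def by (subst diag_mult_append_rows[OF cS cT Bb Bt]) (simp add: SB TB k0_def)
  also have "R * \<dots> = (B2 @\<^sub>r 0\<^sub>m r0 d) @\<^sub>r (B4 @\<^sub>r 0\<^sub>m k0 d) @\<^sub>r 0\<^sub>m v d"
    using B2 B4 by (intro swap) (auto simp: k_eq)
  also have "\<dots> = B2 @\<^sub>r 0\<^sub>m r0 d @\<^sub>r B4 @\<^sub>r 0\<^sub>m k0 d @\<^sub>r 0\<^sub>m v d"
    using B2 B4 by (intro append_rows_regroup) auto
  finally have UB: "U * B = B2 @\<^sub>r 0\<^sub>m r0 d @\<^sub>r B4 @\<^sub>r 0\<^sub>m k0 d @\<^sub>r 0\<^sub>m v d" .
  have "U * C = R * (G * (Cb @\<^sub>r Ct))"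
    using cR cG cP C
    by (simp add: U_def PC[symmetric] assoc_mult_mat[of _ m m _ m _ d])
  also have "G * (Cb @\<^sub>r Ct) = ((C2 @\<^sub>r C3) @\<^sub>r 0\<^sub>m v d) @\<^sub>r (C4 @\<^sub>r C5)"
    unfolding G_def by (subst diag_mult_append_rows[OF cS cT Cb Ct]) (simp add: SC TC)
  also have "R * \<dots> = (C2 @\<^sub>r C3) @\<^sub>r (C4 @\<^sub>r C5) @\<^sub>r 0\<^sub>m v d"
    using C2 C3 C4 C5 by (intro swap) (auto simp: k_eq)
  also have "\<dots> = C2 @\<^sub>r C3 @\<^sub>r C4 @\<^sub>r C5 @\<^sub>r 0\<^sub>m v d"
    using C2 C3 C4 C5 by (intro append_rows_regroup) auto
  finally have UC: "U * C = C2 @\<^sub>r C3 @\<^sub>r C4 @\<^sub>r C5 @\<^sub>r 0\<^sub>m v d" .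
  have cI: "0\<^sub>m k q @\<^sub>c M \<in> carrier_mat k p" if "M \<in> carrier_mat k k" for M :: "real mat"
    using append_cols_carrier[OF zero_carrier_mat[of k q] that] p_eq by simp
  have "G * (0\<^sub>m (m - k) p @\<^sub>r (0\<^sub>m k q @\<^sub>c 1\<^sub>m k)) = 0\<^sub>m (m - k) p @\<^sub>r (0\<^sub>m k q @\<^sub>c T)"
    unfolding G_def
    by (subst diag_mult_append_rows[OF cS cT _ cI])
      (use cS cT in \<open>auto simp: mult_append_cols[OF cT zero_carrier_mat one_carrier_mat]\<close>)
  moreover have "(0\<^sub>m (m - k) p @\<^sub>r (0\<^sub>m k q @\<^sub>c T)) * H = 0\<^sub>m (m - k) p @\<^sub>r (0\<^sub>m k q @\<^sub>c 1\<^sub>m k)"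
    using append_cols_mult_diag[of "0\<^sub>m k q" k q T k "1\<^sub>m q" T'] cT T'
    by (subst append_rows_mult[OF zero_carrier_mat cI[OF cT] cH])
      (use cH in \<open>auto simp: H_def\<close>)
  ultimately have GH: "G * (P * D * Q) * H = (0\<^sub>m (r1 + r0) p @\<^sub>r 0\<^sub>m v p) @\<^sub>r (0\<^sub>m k q @\<^sub>c 1\<^sub>m k)"
    by (simp add: PDQ q_def[symmetric] append_rows_zero m_eq)
  have "U * D * V = R * (G * (P * D * Q) * H)"
    using cR cG cP cQ cH D unfolding U_def V_def
    by (simp add: assoc_mult_mat[of _ m m _ m _ p] assoc_mult_mat[of _ m m _ p _ p]
        assoc_mult_mat[of _ m p _ p _ p] assoc_mult_mat[of _ m m _ m _ m])
  also have "\<dots> = 0\<^sub>m (r1 + r0) p @\<^sub>r (0\<^sub>m k q @\<^sub>c 1\<^sub>m k) @\<^sub>r 0\<^sub>m v p"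
    unfolding GH by (rule swap[OF zero_carrier_mat zero_carrier_mat cI[OF one_carrier_mat]])
  \<comment> \<open>The identity splits along \<open>k = k1 + k0\<close>, the heights of
    \<open>B4\<close> and of the zero rows below it; its diagonal pieces are the future
    \<open>blk_Sigma1\<close> and \<open>blk_Sigma0\<close>.\<close>
  also have "0\<^sub>m k q @\<^sub>c 1\<^sub>m k =
      (0\<^sub>m k1 q @\<^sub>c 1\<^sub>m k1 @\<^sub>c 0\<^sub>m k1 k0) @\<^sub>r (0\<^sub>m k0 q @\<^sub>c 0\<^sub>m k0 k1 @\<^sub>c (1\<^sub>m k0 :: real mat))"
    by (rule eq_matI) (auto simp: append_rows_def append_cols_def k_eq)
  also have "0\<^sub>m (r1 + r0) p @\<^sub>r \<dots> @\<^sub>r 0\<^sub>m v p =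
      0\<^sub>m r1 p @\<^sub>r 0\<^sub>m r0 p @\<^sub>r (0\<^sub>m k1 q @\<^sub>c 1\<^sub>m k1 @\<^sub>c 0\<^sub>m k1 k0) @\<^sub>r
      (0\<^sub>m k0 q @\<^sub>c 0\<^sub>m k0 k1 @\<^sub>c 1\<^sub>m k0) @\<^sub>r 0\<^sub>m v p"
  proof -
    have c1: "0\<^sub>m k1 q @\<^sub>c 1\<^sub>m k1 @\<^sub>c 0\<^sub>m k1 k0 \<in> carrier_mat k1 p"
      and c0: "0\<^sub>m k0 q @\<^sub>c 0\<^sub>m k0 k1 @\<^sub>c 1\<^sub>m k0 \<in> carrier_mat k0 p"
      using p_eq k_eq by (auto simp: append_cols_def)
    show ?thesis
      unfolding append_rows_zero[of r1 p r0, symmetric] append_rows_assoc[OF c1 c0 zero_carrier_mat]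
      by (rule append_rows_assoc[of _ r1 p _ r0 _ "k1 + (k0 + v)"]) (use c1 c0 in auto)
  qed
  finally have UDV: "U * D * V = 0\<^sub>m r1 p @\<^sub>r 0\<^sub>m r0 p @\<^sub>r (0\<^sub>m k1 q @\<^sub>c 1\<^sub>m k1 @\<^sub>c 0\<^sub>m k1 k0) @\<^sub>r
      (0\<^sub>m k0 q @\<^sub>c 0\<^sub>m k0 k1 @\<^sub>c 1\<^sub>m k0) @\<^sub>r 0\<^sub>m v p" .
  have "r1 + r0 + k1 + k0 + v = m" "q + k1 + k0 = p" using m_eq k_eq p_eq by auto
  then show thesis
    using that[OF _ _ U V B2 C2 C3 B4(1) C4 C5 rank B4(2) UB UC UDV] by blast
qed

text \<open>With \<open>X\<close> split into \<open>D1\<close>, \<open>X1\<close> and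
  \<open>X0\<close>, the multiplier \<open>L\<close> has \<open>- X1\<close> and \<open>- X0\<close>
  opposite the two rows of blocks that contain identities and zeros elsewhere. These rows vanish on
  the first \<open>q\<close> columns, so \<open>D1\<close> survives unchanged.\<close>

lemma eliminate_input_columns:
  assumes X: "(X :: real mat) \<in> carrier_mat r (q + k1 + k0)"
  obtains L D1 where "L \<in> carrier_mat r (r1 + r0 + k1 + k0 + v)" "D1 \<in> carrier_mat r q"
    "X + L * (0\<^sub>m r1 (q + k1 + k0) @\<^sub>r 0\<^sub>m r0 (q + k1 + k0) @\<^sub>r
       (0\<^sub>m k1 q @\<^sub>c 1\<^sub>m k1 @\<^sub>c 0\<^sub>m k1 k0) @\<^sub>r (0\<^sub>m k0 q @\<^sub>c 0\<^sub>m k0 k1 @\<^sub>c 1\<^sub>m k0) @\<^sub>r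
       0\<^sub>m v (q + k1 + k0)) = D1 @\<^sub>c 0\<^sub>m r k1 @\<^sub>c 0\<^sub>m r k0"
proof -
  obtain D1 X' where D1: "D1 \<in> carrier_mat r q" and X': "X' \<in> carrier_mat r (k1 + k0)"
    and X_eq': "X = D1 @\<^sub>c X'"
    using X unfolding add.assoc by (rule split_cols)
  obtain X1 X0 where X1: "X1 \<in> carrier_mat r k1" and X0: "X0 \<in> carrier_mat r k0"
    and X'_eq: "X' = X1 @\<^sub>c X0"
    using X' by (rule split_cols)
  let ?p = "q + k1 + k0"
  let ?E1 = "0\<^sub>m k1 q @\<^sub>c 1\<^sub>m k1 @\<^sub>c 0\<^sub>m k1 k0 :: real mat"
  let ?E0 = "0\<^sub>m k0 q @\<^sub>c 0\<^sub>m k0 k1 @\<^sub>c 1\<^sub>m k0 :: real mat"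
  let ?T0 = "?E0 @\<^sub>r 0\<^sub>m v ?p"
  let ?T1 = "?E1 @\<^sub>r ?T0"
  let ?T2 = "0\<^sub>m r0 ?p @\<^sub>r ?T1"
  let ?L0 = "- X0 @\<^sub>c 0\<^sub>m r v"
  let ?L1 = "- X1 @\<^sub>c ?L0"
  let ?L2 = "0\<^sub>m r r0 @\<^sub>c ?L1"
  let ?LL = "0\<^sub>m r r1 @\<^sub>c ?L2"
  have E1: "?E1 \<in> carrier_mat k1 ?p" and E0: "?E0 \<in> carrier_mat k0 ?p"
    by (auto simp: append_cols_def)
  have T0: "?T0 \<in> carrier_mat (k0 + v) ?p" using E0 by auto
  have T1: "?T1 \<in> carrier_mat (k1 + (k0 + v)) ?p" using E1 T0 by auto
  have T2: "?T2 \<in> carrier_mat (r0 + (k1 + (k0 + v))) ?p" using T1 by auto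
  have L0: "?L0 \<in> carrier_mat r (k0 + v)" using X0 by auto
  have L1: "?L1 \<in> carrier_mat r (k1 + (k0 + v))" using X1 L0 by auto
  have L2: "?L2 \<in> carrier_mat r (r0 + (k1 + (k0 + v)))" using L1 by auto
  have L: "?LL \<in> carrier_mat r (r1 + r0 + k1 + k0 + v)"
    using append_cols_carrier[OF _ L2, of "0\<^sub>m r r1" r1] by (simp add: add.assoc)
  have XE1: "- X1 * ?E1 = 0\<^sub>m r q @\<^sub>c - X1 @\<^sub>c 0\<^sub>m r k0"
    using X1 by (subst mult_append_cols[of _ r k1 _ q _ "k1 + k0"])
      (auto simp: mult_append_cols[of _ r k1 _ k1 _ k0])
  have XE0: "- X0 * ?E0 = 0\<^sub>m r q @\<^sub>c 0\<^sub>m r k1 @\<^sub>c - X0"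
    using X0 by (subst mult_append_cols[of _ r k0 _ q _ "k1 + k0"])
      (auto simp: mult_append_cols[of _ r k0 _ k1 _ k0])
  \<comment> \<open>The product is evaluated one block at a time. The two leading blocks and the
    last one contribute nothing, which leaves the two terms with identities.\<close>
  have "?LL * (0\<^sub>m r1 ?p @\<^sub>r ?T2) = ?L2 * ?T2"
    using L2 T2 by (subst append_cols_mult_append_rows[OF _ L2 _ T2]) auto
  also have "\<dots> = ?L1 * ?T1"
    using L1 T1 by (subst append_cols_mult_append_rows[OF _ L1 _ T1]) auto
  also have "\<dots> = - X1 * ?E1 + ?L0 * ?T0"
    using X1 by (subst append_cols_mult_append_rows[OF _ L0 E1 T0]) auto
  also have "?L0 * ?T0 = - X0 * ?E0"
    using X0 E0 by (subst append_cols_mult_append_rows[OF _ _ E0]) auto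
  also have "- X1 * ?E1 + \<dots> = 0\<^sub>m r q @\<^sub>c - X1 @\<^sub>c - X0"
    unfolding XE1 XE0 using X1 X0
    by (subst add_append_cols[of _ r q _ "k1 + k0"])
      (auto simp: add_append_cols[of _ r k1 _ k0])
  finally have eq: "?LL * (0\<^sub>m r1 ?p @\<^sub>r ?T2) = 0\<^sub>m r q @\<^sub>c - X1 @\<^sub>c - X0" .
  have "X + ?LL * (0\<^sub>m r1 ?p @\<^sub>r ?T2) = D1 @\<^sub>c 0\<^sub>m r k1 @\<^sub>c 0\<^sub>m r k0"
    unfolding eq unfolding X_eq' X'_eq using X1 X0 D1
    by (subst add_append_cols[of _ r q _ "k1 + k0"])
      (auto simp: add_append_cols[of _ r k1 _ k0] uminus_r_inv_mat[of _ r k1] uminus_r_inv_mat[of _ r k0])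
  then show thesis using that[OF L D1] by blast
qed

text \<open>\<open>A\<close> is compressed first, the rows below the leading block are condensed by
  \<open>W\<close>, and multiples of them are added to the leading rows. Since \<open>A\<close> is
  zero in the lower rows, this changes \<open>B\<close>, \<open>C\<close> and the input matrix in
  the leading rows but keeps \<open>A1\<close>.\<close>

lemma condensed_form_pointwise:
  assumes A: "A \<in> carrier_mat m d" and B: "B \<in> carrier_mat m d"
    and C: "C \<in> carrier_mat m d" and D: "D \<in> carrier_mat m p"
  obtains U V K where "nonsingular m U" "nonsingular p V" "admissible_blocks m d p K"
    "U * A = condensed_A d K" "U * B = condensed_B d K" "U * C = condensed_C d K"
    "U * D * V = condensed_D p K"
proof -
  obtain r2 U1 A1 where r2: "r2 \<le> m" and U1: "nonsingular m U1"
    and A1: "A1 \<in> carrier_mat r2 d" "full_row_rank A1" and U1A: "U1 * A = A1 @\<^sub>r 0\<^sub>m (m - r2) d"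
    using row_compression[OF A] by metis
  note cU1 = nonsingular_carrier[OF U1]
  have m: "r2 + (m - r2) = m" using r2 by simp
  have "U1 * B \<in> carrier_mat (r2 + (m - r2)) d" using cU1 B m by auto
  then obtain Bt Bb where Bt: "Bt \<in> carrier_mat r2 d" and Bb: "Bb \<in> carrier_mat (m - r2) d"
    and U1B: "U1 * B = Bt @\<^sub>r Bb" by (rule split_rows)
  have "U1 * C \<in> carrier_mat (r2 + (m - r2)) d" using cU1 C m by auto
  then obtain Ct Cb where Ct: "Ct \<in> carrier_mat r2 d" and Cb: "Cb \<in> carrier_mat (m - r2) d"
    and U1C: "U1 * C = Ct @\<^sub>r Cb" by (rule split_rows)
  have "U1 * D \<in> carrier_mat (r2 + (m - r2)) p" using cU1 D m by auto
  then obtain Dt Db where Dt: "Dt \<in> carrier_mat r2 p" and Db: "Db \<in> carrier_mat (m - r2) p"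
    and U1D: "U1 * D = Dt @\<^sub>r Db" by (rule split_rows)
  obtain r1 r0 k1 k0 v q W V B2 B4 C2 C3 C4 C5 where
    sizes: "r1 + r0 + k1 + k0 + v = m - r2" "q + k1 + k0 = p"
    and W: "nonsingular (m - r2) W" and V: "nonsingular p V"
    and blocks: "B2 \<in> carrier_mat r1 d" "C2 \<in> carrier_mat r1 d" "C3 \<in> carrier_mat r0 d"
      "B4 \<in> carrier_mat k1 d" "C4 \<in> carrier_mat k1 d" "C5 \<in> carrier_mat k0 d"
    and ranks: "full_row_rank B2" "full_row_rank C3" "full_row_rank B4"
    and WB: "W * Bb = B2 @\<^sub>r 0\<^sub>m r0 d @\<^sub>r B4 @\<^sub>r 0\<^sub>m k0 d @\<^sub>r 0\<^sub>m v d"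
    and WC: "W * Cb = C2 @\<^sub>r C3 @\<^sub>r C4 @\<^sub>r C5 @\<^sub>r 0\<^sub>m v d"
    and WDV: "W * Db * V = 0\<^sub>m r1 p @\<^sub>r 0\<^sub>m r0 p @\<^sub>r (0\<^sub>m k1 q @\<^sub>c 1\<^sub>m k1 @\<^sub>c 0\<^sub>m k1 k0) @\<^sub>r
      (0\<^sub>m k0 q @\<^sub>c 0\<^sub>m k0 k1 @\<^sub>c 1\<^sub>m k0) @\<^sub>r 0\<^sub>m v p"
    by (rule condense_below_leading_block[OF Bb Cb Db])
  note cW = nonsingular_carrier[OF W] and cV = nonsingular_carrier[OF V]
  have "Dt * V \<in> carrier_mat r2 (q + k1 + k0)" using Dt cV sizes by auto
  then obtain L D1 where L: "L \<in> carrier_mat r2 (m - r2)" and D1: "D1 \<in> carrier_mat r2 q"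
    and DL: "Dt * V + L * (W * Db * V) = D1 @\<^sub>c 0\<^sub>m r2 k1 @\<^sub>c 0\<^sub>m r2 k0"
    using eliminate_input_columns[of "Dt * V" r2 q k1 k0 r1 r0 v] unfolding WDV sizes by metis
  have LW: "L * W \<in> carrier_mat r2 (m - r2)" using L cW by auto
  \<comment> \<open>The corner is \<open>L * W\<close> because \<open>L\<close> refers to the lower
    rows after condensation by \<open>W\<close>, whereas \<open>G\<close> acts on them before
    it.\<close>
  define G where "G = four_block_mat (1\<^sub>m r2) (L * W) (0\<^sub>m (m - r2) r2) W"
  have G: "nonsingular m G"
    using nonsingular_block_upper[OF nonsingular_one W LW] m by (simp add: G_def)
  note cG = nonsingular_carrier[OF G]
  have mult: "G * (X @\<^sub>r Y) = (X + L * W * Y) @\<^sub>r W * Y"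
    if "X \<in> carrier_mat r2 c" "Y \<in> carrier_mat (m - r2) c" for X Y c
    unfolding G_def by (subst four_block_mult_append_rows[OF _ LW _ cW that]) (use that cW in auto)
  define B1 where "B1 = Bt + L * W * Bb"
  define C1 where "C1 = Ct + L * W * Cb"
  have B1: "B1 \<in> carrier_mat r2 d" and C1: "C1 \<in> carrier_mat r2 d"
    using Bt LW Bb Ct Cb by (auto simp: B1_def C1_def)
  define K where "K = \<lparr>sz_r2 = r2, sz_r1 = r1, sz_r0 = r0, sz_phi1 = k1, sz_phi0 = k0, sz_v = v,
    blk_A1 = A1, blk_B1 = B1, blk_B2 = B2, blk_B4 = B4, blk_C1 = C1, blk_C2 = C2, blk_C3 = C3,
    blk_C4 = C4, blk_C5 = C5, blk_D1 = D1, blk_Sigma1 = 1\<^sub>m k1, blk_Sigma0 = 1\<^sub>m k0\<rparr>"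
  have q: "p - (k1 + k0) = q" using sizes(2) by simp
  have "admissible_blocks m d p K"
    unfolding admissible_blocks_def K_def
    using sizes m A1 B1 C1 D1 blocks ranks nonsingular_one
    by (auto simp: q diagonal_mat_def)
  moreover have "G * U1 * A = condensed_A d K"
  proof -
    have "G * U1 * A = G * (A1 @\<^sub>r 0\<^sub>m (m - r2) d)"
      using cG cU1 A by (simp add: U1A[symmetric])
    also have "\<dots> = A1 @\<^sub>r 0\<^sub>m (m - r2) d"
      using A1(1) LW cW by (subst mult) auto
    finally show ?thesis
      by (simp add: condensed_A_def K_def append_rows_zero sizes(1)[symmetric] add.assoc)
  qed
  moreover have "G * U1 * B = condensed_B d K"
  proof -
    have "G * U1 * B = G * (Bt @\<^sub>r Bb)"
      using cG cU1 B by (simp add: U1B[symmetric])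
    also have "\<dots> = B1 @\<^sub>r W * Bb"
      using Bt Bb by (subst mult) (auto simp: B1_def)
    finally show ?thesis
      by (simp add: condensed_B_def K_def WB)
  qed
  moreover have "G * U1 * C = condensed_C d K"
  proof -
    have "G * U1 * C = G * (Ct @\<^sub>r Cb)"
      using cG cU1 C by (simp add: U1C[symmetric])
    also have "\<dots> = C1 @\<^sub>r W * Cb"
      using Ct Cb by (subst mult) (auto simp: C1_def)
    finally show ?thesis
      by (simp add: condensed_C_def K_def WC)
  qed
  moreover have "G * U1 * D * V = condensed_D p K"
  proof -
    have "G * U1 * D * V = G * (Dt @\<^sub>r Db) * V"
      using cG cU1 D by (simp add: U1D[symmetric])
    also have "\<dots> = ((Dt + L * W * Db) @\<^sub>r W * Db) * V"
      using Dt Db by (subst mult) auto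
    also have "\<dots> = (Dt + L * W * Db) * V @\<^sub>r W * Db * V"
      using Dt Db LW cW cV by (intro append_rows_mult) auto
    \<comment> \<open>The column transformation \<open>V\<close> is distributed over the sum, so
      that the elimination identity \<open>DL\<close>, stated for inputs already transformed by
      \<open>V\<close>, applies.\<close>
    also have "(Dt + L * W * Db) * V = Dt * V + L * (W * Db * V)"
      using Dt Db L cW cV
      by (subst add_mult_distrib_mat[of _ r2 p])
        (auto simp: assoc_mult_mat[of _ r2 "m - r2" _ "m - r2" _ p]
          assoc_mult_mat[of _ r2 "m - r2" _ p _ p] assoc_mult_mat[of _ "m - r2" "m - r2" _ p _ p])
    finally show ?thesis
      using sizes(2) unfolding DL
      by (simp add: condensed_D_def K_def WDV q append_cols_zero add.assoc)
  qed
  ultimately show thesis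
    using that[OF nonsingular_mult[OF G U1] V] by blast
qed

subsection \<open>Equivalence of the systems and feedback\<close>

lemma nonsingular_mult_vec_eq_iff:
  assumes U: "nonsingular k U" and a: "a \<in> carrier_vec k" and b: "b \<in> carrier_vec k"
  shows "U *\<^sub>v a = U *\<^sub>v b \<longleftrightarrow> a = b"
proof
  assume eq: "U *\<^sub>v a = U *\<^sub>v b"
  obtain N where N: "N \<in> carrier_mat k k" "N * U = 1\<^sub>m k"
    using U by (rule nonsingularE)
  have "N *\<^sub>v (U *\<^sub>v x) = x" if "x \<in> carrier_vec k" for x
    using assoc_mult_mat_vec[OF N(1) nonsingular_carrier[OF U] that] that by (simp add: N(2))
  then show "a = b" using a b eq by metis
qed simp

text \<open>The scaled left-hand side is \<open>U\<close> applied to the original one at the input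
  \<open>V *\<^sub>v v\<close>. Multiplication by \<open>U\<close> is injective, which makes the
  scaling reversible.\<close>

lemma scaled_equation_iff:
  assumes U: "nonsingular m U" and V: "V \<in> carrier_mat p p"
    and A: "A \<in> carrier_mat m d" and B: "B \<in> carrier_mat m d"
    and C: "C \<in> carrier_mat m d" and D: "D \<in> carrier_mat m p" and f: "f \<in> carrier_vec m"
    and x: "x \<in> carrier_vec d" and y: "y \<in> carrier_vec d" and z: "z \<in> carrier_vec d"
    and v: "v \<in> carrier_vec p"
  shows "A *\<^sub>v x + B *\<^sub>v y + C *\<^sub>v z + D *\<^sub>v (V *\<^sub>v v) = f \<longleftrightarrow>
    (U * A) *\<^sub>v x + (U * B) *\<^sub>v y + (U * C) *\<^sub>v z + (U * D * V) *\<^sub>v v = U *\<^sub>v f"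
proof -
  note cU = nonsingular_carrier[OF U]
  have UD: "U * D \<in> carrier_mat m p" and Vv: "V *\<^sub>v v \<in> carrier_vec p"
    using cU D V v by auto
  have DV: "(U * D * V) *\<^sub>v v = U *\<^sub>v (D *\<^sub>v (V *\<^sub>v v))"
    using assoc_mult_mat_vec[OF UD V v] assoc_mult_mat_vec[OF cU D Vv] by simp
  have "(U * A) *\<^sub>v x + (U * B) *\<^sub>v y + (U * C) *\<^sub>v z + (U * D * V) *\<^sub>v v =
    U *\<^sub>v (A *\<^sub>v x + B *\<^sub>v y + C *\<^sub>v z + D *\<^sub>v (V *\<^sub>v v))"
    unfolding DV using A B C D V x y z v cU
    by (simp add: mult_add_distrib_mat_vec[of _ m m] assoc_mult_mat_vec[of _ m m _ d])
  then show ?thesis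
    using nonsingular_mult_vec_eq_iff[OF U _ f] A B C D V x y z v by simp
qed

section \<open>State feedback that cancels the rows with input\<close>

text \<open>\<open>F\<close> stacks a zero block, the inverse of \<open>blk_Sigma1 K\<close> times
  \<open>Y4\<close>, and the inverse of \<open>blk_Sigma0 K\<close> times \<open>Y5\<close>. The
  zero block silences \<open>blk_D1 K\<close>, so arbitrary values can be produced in the two
  controlled block rows without disturbing any other.\<close>

lemma feedback_through_input:
  assumes K: "admissible_blocks m d p K"
    and Y4: "Y4 \<in> carrier_mat (sz_phi1 K) d" and Y5: "Y5 \<in> carrier_mat (sz_phi0 K) d"
  obtains F where "F \<in> carrier_mat p d"
    "condensed_D p K * F = 0\<^sub>m (sz_r2 K) d @\<^sub>r 0\<^sub>m (sz_r1 K) d @\<^sub>r 0\<^sub>m (sz_r0 K) d @\<^sub>r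
       Y4 @\<^sub>r Y5 @\<^sub>r 0\<^sub>m (sz_v K) d"
proof -
  define k1 where "k1 = sz_phi1 K"
  define k0 where "k0 = sz_phi0 K"
  define q where "q = p - (k1 + k0)"
  have p: "q + (k1 + k0) = p"
    using K by (auto simp: q_def k1_def k0_def admissible_blocks_def)
  have S1: "nonsingular k1 (blk_Sigma1 K)" and S0: "nonsingular k0 (blk_Sigma0 K)"
    and D1: "blk_D1 K \<in> carrier_mat (sz_r2 K) q"
    using K by (auto simp: admissible_blocks_def k1_def k0_def q_def)
  obtain T1 where T1: "T1 \<in> carrier_mat k1 k1" "blk_Sigma1 K * T1 = 1\<^sub>m k1"
    using S1 by (rule nonsingularE)
  obtain T0 where T0: "T0 \<in> carrier_mat k0 k0" "blk_Sigma0 K * T0 = 1\<^sub>m k0"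
    using S0 by (rule nonsingularE)
  note cS1 = nonsingular_carrier[OF S1] and cS0 = nonsingular_carrier[OF S0]
  have Y: "Y4 \<in> carrier_mat k1 d" "Y5 \<in> carrier_mat k0 d" using Y4 Y5 by (auto simp: k1_def k0_def)
  define F where "F = 0\<^sub>m q d @\<^sub>r T1 * Y4 @\<^sub>r T0 * Y5"
  have TY: "T1 * Y4 \<in> carrier_mat k1 d" "T0 * Y5 \<in> carrier_mat k0 d" using T1 T0 Y by auto
  have ST: "blk_Sigma1 K * (T1 * Y4) = Y4" "blk_Sigma0 K * (T0 * Y5) = Y5"
    using assoc_mult_mat[OF cS1 T1(1) Y(1)] assoc_mult_mat[OF cS0 T0(1) Y(2)] T1 T0 Y by auto
  have F: "F \<in> carrier_mat p d"
    using carrier_append_rows[OF zero_carrier_mat[of q d] carrier_append_rows[OF TY]]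
    by (simp add: F_def p)
  have row: "(X1 @\<^sub>c X2 @\<^sub>c X3) * F = X2 * (T1 * Y4) + X3 * (T0 * Y5)"
    and row_carrier: "X1 @\<^sub>c X2 @\<^sub>c X3 \<in> carrier_mat a p"
    if "X1 \<in> carrier_mat a q" "X2 \<in> carrier_mat a k1" "X3 \<in> carrier_mat a k0" for X1 X2 X3 :: "real mat" and a
  proof -
    have "X2 @\<^sub>c X3 \<in> carrier_mat a (k1 + k0)" using that by auto
    then show "X1 @\<^sub>c X2 @\<^sub>c X3 \<in> carrier_mat a p" using append_cols_carrier[OF that(1)] p by metis
    show "(X1 @\<^sub>c X2 @\<^sub>c X3) * F = X2 * (T1 * Y4) + X3 * (T0 * Y5)"
      unfolding F_def using that TY
      by (subst append_cols_mult_append_rows[OF that(1) append_cols_carrier[OF that(2,3)] _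
            carrier_append_rows[OF TY]])
        (auto simp: append_cols_mult_append_rows[OF that(2,3) TY])
  qed
  let ?z = "\<lambda>a. 0\<^sub>m a q @\<^sub>c 0\<^sub>m a k1 @\<^sub>c 0\<^sub>m a k0 :: real mat"
  let ?R1 = "blk_D1 K @\<^sub>c 0\<^sub>m (sz_r2 K) k1 @\<^sub>c 0\<^sub>m (sz_r2 K) k0"
  let ?R4 = "0\<^sub>m k1 q @\<^sub>c blk_Sigma1 K @\<^sub>c 0\<^sub>m k1 k0"
  let ?R5 = "0\<^sub>m k0 q @\<^sub>c 0\<^sub>m k0 k1 @\<^sub>c blk_Sigma0 K"
  have c: "?R1 \<in> carrier_mat (sz_r2 K) p" "?z (sz_r1 K) \<in> carrier_mat (sz_r1 K) p"
    "?z (sz_r0 K) \<in> carrier_mat (sz_r0 K) p" "?R4 \<in> carrier_mat k1 p" "?R5 \<in> carrier_mat k0 p"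
    "?z (sz_v K) \<in> carrier_mat (sz_v K) p"
    by (intro row_carrier D1 cS1 cS0 zero_carrier_mat)+
  note c5 = carrier_append_rows[OF c(5,6)]
  note c4 = carrier_append_rows[OF c(4) c5]
  note c3 = carrier_append_rows[OF c(3) c4]
  note c2 = carrier_append_rows[OF c(2) c3]
  note zero_mult = left_mult_zero_mat[OF TY(1)] left_mult_zero_mat[OF TY(2)]
  have z: "?z a * F = 0\<^sub>m a d" for a
    by (simp add: row[OF zero_carrier_mat zero_carrier_mat zero_carrier_mat] zero_mult)
  have R1: "?R1 * F = 0\<^sub>m (sz_r2 K) d"
    by (simp add: row[OF D1 zero_carrier_mat zero_carrier_mat] zero_mult)
  have R4: "?R4 * F = Y4"
    using Y by (simp add: row[OF zero_carrier_mat cS1 zero_carrier_mat] ST zero_mult)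
  have R5: "?R5 * F = Y5"
    using Y by (simp add: row[OF zero_carrier_mat zero_carrier_mat cS0] ST zero_mult)
  have "condensed_D p K * F = 0\<^sub>m (sz_r2 K) d @\<^sub>r 0\<^sub>m (sz_r1 K) d @\<^sub>r 0\<^sub>m (sz_r0 K) d @\<^sub>r
       Y4 @\<^sub>r Y5 @\<^sub>r 0\<^sub>m (sz_v K) d"
    unfolding condensed_D_def Let_def k1_def[symmetric] k0_def[symmetric] q_def[symmetric]
      append_rows_mult[OF c(1) c2 F] append_rows_mult[OF c(2) c3 F] append_rows_mult[OF c(3) c4 F]
      append_rows_mult[OF c(4) c5 F] append_rows_mult[OF c(5,6) F] z R1 R4 R5 ..
  then show thesis using that F by blast
qed

text \<open>The feedback is aimed at the negatives of the blocks in the two controlled block rows.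
  These rows become zero and join the \<open>sz_v K\<close> rows that were zero before, while all
  other blocks keep their values.\<close>

lemma closed_loop_pointwise:
  assumes U: "nonsingular m U" and V: "V \<in> carrier_mat p p" and K: "admissible_blocks m d p K"
    and B: "B \<in> carrier_mat m d" and C: "C \<in> carrier_mat m d" and D: "D \<in> carrier_mat m p"
    and UB: "U * B = condensed_B d K" and UC: "U * C = condensed_C d K"
    and UDV: "U * D * V = condensed_D p K"
  obtains F1 F0 where "F1 \<in> carrier_mat p d" "F0 \<in> carrier_mat p d"
    "U * (B + D * V * F1) = blk_B1 K @\<^sub>r blk_B2 K @\<^sub>r 0\<^sub>m (sz_r0 K) d @\<^sub>r
       0\<^sub>m (sz_phi1 K + sz_phi0 K + sz_v K) d"
    "U * (C + D * V * F0) = blk_C1 K @\<^sub>r blk_C2 K @\<^sub>r blk_C3 K @\<^sub>r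
       0\<^sub>m (sz_phi1 K + sz_phi0 K + sz_v K) d"
proof -
  note cU = nonsingular_carrier[OF U]
  let ?w = "sz_phi1 K + sz_phi0 K + sz_v K"
  have cB: "blk_B1 K \<in> carrier_mat (sz_r2 K) d" "blk_B2 K \<in> carrier_mat (sz_r1 K) d"
    and cC: "blk_C1 K \<in> carrier_mat (sz_r2 K) d" "blk_C2 K \<in> carrier_mat (sz_r1 K) d"
      "blk_C3 K \<in> carrier_mat (sz_r0 K) d"
    and cY: "blk_B4 K \<in> carrier_mat (sz_phi1 K) d" "blk_C4 K \<in> carrier_mat (sz_phi1 K) d"
      "blk_C5 K \<in> carrier_mat (sz_phi0 K) d"
    using K by (auto simp: admissible_blocks_def)
  have cancel: "(X1 @\<^sub>r X2 @\<^sub>r X3 @\<^sub>r X4 @\<^sub>r X5 @\<^sub>r 0\<^sub>m (sz_v K) d) +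
      (0\<^sub>m (sz_r2 K) d @\<^sub>r 0\<^sub>m (sz_r1 K) d @\<^sub>r 0\<^sub>m (sz_r0 K) d @\<^sub>r - X4 @\<^sub>r - X5 @\<^sub>r 0\<^sub>m (sz_v K) d)
      = X1 @\<^sub>r X2 @\<^sub>r X3 @\<^sub>r 0\<^sub>m ?w d"
    if X: "X1 \<in> carrier_mat (sz_r2 K) d" "X2 \<in> carrier_mat (sz_r1 K) d"
      "X3 \<in> carrier_mat (sz_r0 K) d" "X4 \<in> carrier_mat (sz_phi1 K) d"
      "X5 \<in> carrier_mat (sz_phi0 K) d" for X1 X2 X3 X4 X5 :: "real mat"
  proof -
    let ?z = "\<lambda>k. 0\<^sub>m k d :: real mat"
    have z: "?z k \<in> carrier_mat k d" for k by simp
    have n: "- X4 \<in> carrier_mat (sz_phi1 K) d" "- X5 \<in> carrier_mat (sz_phi0 K) d"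
      using X by auto
    note c5 = carrier_append_rows[OF X(5) z[of "sz_v K"]]
      and c4 = carrier_append_rows[OF X(4) carrier_append_rows[OF X(5) z[of "sz_v K"]]]
    note c3 = carrier_append_rows[OF X(3) c4]
    note c2 = carrier_append_rows[OF X(2) c3]
    note e5 = carrier_append_rows[OF n(2) z[of "sz_v K"]]
    note e4 = carrier_append_rows[OF n(1) e5]
    note e3 = carrier_append_rows[OF z[of "sz_r0 K"] e4]
    note e2 = carrier_append_rows[OF z[of "sz_r1 K"] e3]
    show ?thesis
      unfolding add_append_rows[OF X(1) c2 z e2] add_append_rows[OF X(2) c3 z e3]
        add_append_rows[OF X(3) c4 z e4] add_append_rows[OF X(4) c5 n(1) e5]
        add_append_rows[OF X(5) z n(2) z] uminus_r_inv_mat[OF X(4)] uminus_r_inv_mat[OF X(5)]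
        right_add_zero_mat[OF X(1)] right_add_zero_mat[OF X(2)] right_add_zero_mat[OF X(3)]
        right_add_zero_mat[OF z] append_rows_zero
      by (simp add: add.assoc)
  qed
  have nY: "- blk_B4 K \<in> carrier_mat (sz_phi1 K) d" "- blk_C4 K \<in> carrier_mat (sz_phi1 K) d"
      "- blk_C5 K \<in> carrier_mat (sz_phi0 K) d" "- 0\<^sub>m (sz_phi0 K) d \<in> carrier_mat (sz_phi0 K) d"
    using cY by auto
  \<comment> \<open>In the last controlled block row the coefficient of the state at time
    \<open>n + 1\<close> is already zero. The target is written \<open>- 0\<^sub>m\<close> so that
    \<open>cancel\<close> applies with a zero block for \<open>X5\<close>.\<close>
  obtain F1 where F1: "F1 \<in> carrier_mat p d"
    and DF1: "condensed_D p K * F1 = 0\<^sub>m (sz_r2 K) d @\<^sub>r 0\<^sub>m (sz_r1 K) d @\<^sub>r 0\<^sub>m (sz_r0 K) d @\<^sub>r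
       - blk_B4 K @\<^sub>r - 0\<^sub>m (sz_phi0 K) d @\<^sub>r 0\<^sub>m (sz_v K) d"
    by (rule feedback_through_input[OF K nY(1) nY(4)])
  obtain F0 where F0: "F0 \<in> carrier_mat p d"
    and DF0: "condensed_D p K * F0 = 0\<^sub>m (sz_r2 K) d @\<^sub>r 0\<^sub>m (sz_r1 K) d @\<^sub>r 0\<^sub>m (sz_r0 K) d @\<^sub>r
       - blk_C4 K @\<^sub>r - blk_C5 K @\<^sub>r 0\<^sub>m (sz_v K) d"
    by (rule feedback_through_input[OF K nY(2,3)])
  have dist: "U * (M + D * V * F) = U * M + condensed_D p K * F"
    if "M \<in> carrier_mat m d" "F \<in> carrier_mat p d" for M F
  proof -
    have DV: "D * V \<in> carrier_mat m p" using D V by simp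
    have "U * (M + D * V * F) = U * M + U * (D * V * F)"
      using cU that DV by (intro mult_add_distrib_mat[of _ m m]) auto
    also have "U * (D * V * F) = condensed_D p K * F"
      using assoc_mult_mat[OF cU DV that(2)] assoc_mult_mat[OF cU D V] by (simp add: UDV)
    finally show ?thesis .
  qed
  have "U * (B + D * V * F1) = blk_B1 K @\<^sub>r blk_B2 K @\<^sub>r 0\<^sub>m (sz_r0 K) d @\<^sub>r 0\<^sub>m ?w d"
    unfolding dist[OF B F1] UB DF1 condensed_B_def using cB cY by (intro cancel) auto
  moreover have "U * (C + D * V * F0) = blk_C1 K @\<^sub>r blk_C2 K @\<^sub>r blk_C3 K @\<^sub>r 0\<^sub>m ?w d"
    unfolding dist[OF C F0] UC DF0 condensed_C_def using cC cY by (intro cancel) auto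
  ultimately show thesis using that F1 F0 by blast
qed

section \<open>From single times to sequences\<close>

lemma condensed_formD:
  assumes "condensed_form n0 m d p A B C D U V K" "n \<ge> n0"
  shows "nonsingular m (U n)" "nonsingular p (V n)" "admissible_blocks m d p (K n)"
    "U n * A n = condensed_A d (K n)" "U n * B n = condensed_B d (K n)"
    "U n * C n = condensed_C d (K n)" "U n * D n * V n = condensed_D p (K n)"
  using assms unfolding condensed_form_def by simp_all

text \<open>The condensed form imposes no relation between different times, so the transformations
  found at each \<open>n \<ge> n0\<close> can be chosen independently and collected into
  sequences.\<close>

lemma condensed_form_exists:
  assumes "\<And>n. n \<ge> n0 \<Longrightarrow> A n \<in> carrier_mat m d" "\<And>n. n \<ge> n0 \<Longrightarrow> B n \<in> carrier_mat m d"
    and "\<And>n. n \<ge> n0 \<Longrightarrow> C n \<in> carrier_mat m d" "\<And>n. n \<ge> n0 \<Longrightarrow> D n \<in> carrier_mat m p"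
  obtains U V K where "condensed_form n0 m d p A B C D U V K"
proof -
  define Q where "Q n U V K \<longleftrightarrow> nonsingular m U \<and> nonsingular p V \<and> admissible_blocks m d p K \<and>
      U * A n = condensed_A d K \<and> U * B n = condensed_B d K \<and>
      U * C n = condensed_C d K \<and> U * D n * V = condensed_D p K" for n U V K
  have "\<exists>U V K. Q n U V K" if n: "n \<ge> n0" for n
    by (rule condensed_form_pointwise[OF assms(1)[OF n] assms(2)[OF n] assms(3)[OF n] assms(4)[OF n]])
      (unfold Q_def, blast)
  then obtain U V K where "\<And>n. n \<ge> n0 \<Longrightarrow> Q n (U n) (V n) (K n)"
    by metis
  then have "condensed_form n0 m d p A B C D U V K"
    unfolding condensed_form_def Q_def by blast
  then show thesis by (rule that)
qed

lemma condensed_form_descriptor_system_iff: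
  assumes "condensed_form n0 m d p A B C D U V K"
    and "\<And>n. n \<ge> n0 \<Longrightarrow> A n \<in> carrier_mat m d" "\<And>n. n \<ge> n0 \<Longrightarrow> B n \<in> carrier_mat m d"
    and "\<And>n. n \<ge> n0 \<Longrightarrow> C n \<in> carrier_mat m d" "\<And>n. n \<ge> n0 \<Longrightarrow> D n \<in> carrier_mat m p"
    and "\<And>n. n \<ge> n0 \<Longrightarrow> f n \<in> carrier_vec m"
    and "\<And>n. n \<ge> n0 \<Longrightarrow> x n \<in> carrier_vec d" "\<And>n. n \<ge> n0 \<Longrightarrow> v n \<in> carrier_vec p"
  shows "descriptor_system n0 A B C D f x (\<lambda>n. V n *\<^sub>v v n) \<longleftrightarrow>
    descriptor_system n0 (\<lambda>n. condensed_A d (K n)) (\<lambda>n. condensed_B d (K n))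
      (\<lambda>n. condensed_C d (K n)) (\<lambda>n. condensed_D p (K n)) (\<lambda>n. U n *\<^sub>v f n) x v"
proof -
  have "A n *\<^sub>v x (n + 2) + B n *\<^sub>v x (n + 1) + C n *\<^sub>v x n + D n *\<^sub>v (V n *\<^sub>v v n) = f n \<longleftrightarrow>
      condensed_A d (K n) *\<^sub>v x (n + 2) + condensed_B d (K n) *\<^sub>v x (n + 1) +
      condensed_C d (K n) *\<^sub>v x n + condensed_D p (K n) *\<^sub>v v n = U n *\<^sub>v f n" if n: "n \<ge> n0" for n
  proof -
    note * = condensed_formD[OF assms(1) n]
    show ?thesis
      unfolding *(4-7)[symmetric]
      by (rule scaled_equation_iff[OF *(1) nonsingular_carrier[OF *(2)]]) (use assms(2-) n in auto)
  qed
  then show ?thesis unfolding descriptor_system_def by blast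
qed

text \<open>The size functions are quantified after the feedback and only have to agree with the
  condensed sizes for \<open>n \<ge> n0\<close>. One and the same feedback thus serves both the
  varying sizes and, when available, constant ones.\<close>

lemma condensed_form_closed_loop:
  assumes cf: "condensed_form n0 m d p A B C D U V K"
    and B: "\<And>n. n \<ge> n0 \<Longrightarrow> B n \<in> carrier_mat m d"
    and C: "\<And>n. n \<ge> n0 \<Longrightarrow> C n \<in> carrier_mat m d" and D: "\<And>n. n \<ge> n0 \<Longrightarrow> D n \<in> carrier_mat m p"
    and rank: "\<forall>n\<ge>n0. full_row_rank (blk_A1 (K n) @\<^sub>r blk_B2 (K (n + 1)) @\<^sub>r blk_C3 (K (n + 2)))"
  obtains F1 F0 where "\<forall>n\<ge>n0. F1 n \<in> carrier_mat p d \<and> F0 n \<in> carrier_mat p d"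
    "\<forall>s2 s1 s0 w. (\<forall>n\<ge>n0. s2 n = sz_r2 (K n) \<and> s1 n = sz_r1 (K n) \<and> s0 n = sz_r0 (K n) \<and>
        s2 n + s1 n + s0 n + w n = m) \<longrightarrow>
      strangeness_free_with_sizes n0 m d s2 s1 s0 w
        A (\<lambda>n. B n + D n * V n * F1 n) (\<lambda>n. C n + D n * V n * F0 n)"
proof -
  let ?w = "\<lambda>n. sz_phi1 (K n) + sz_phi0 (K n) + sz_v (K n)"
  define Q where "Q n F1 F0 \<longleftrightarrow> F1 \<in> carrier_mat p d \<and> F0 \<in> carrier_mat p d \<and>
      U n * (B n + D n * V n * F1) = blk_B1 (K n) @\<^sub>r blk_B2 (K n) @\<^sub>r 0\<^sub>m (sz_r0 (K n)) d @\<^sub>r 0\<^sub>m (?w n) d \<and>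
      U n * (C n + D n * V n * F0) = blk_C1 (K n) @\<^sub>r blk_C2 (K n) @\<^sub>r blk_C3 (K n) @\<^sub>r 0\<^sub>m (?w n) d"
    for n F1 F0
  have "\<exists>F1 F0. Q n F1 F0" if n: "n \<ge> n0" for n
  proof -
    note * = condensed_formD[OF cf n]
    show ?thesis
      by (rule closed_loop_pointwise[OF *(1) nonsingular_carrier[OF *(2)] *(3) B[OF n] C[OF n] D[OF n]
            *(5-7)]) (unfold Q_def, (rule exI)+, intro conjI)
  qed
  then obtain F1 F0 where Q: "\<And>n. n \<ge> n0 \<Longrightarrow> Q n (F1 n) (F0 n)"
    by metis
  have F: "F1 n \<in> carrier_mat p d" "F0 n \<in> carrier_mat p d"
      "U n * (B n + D n * V n * F1 n) = blk_B1 (K n) @\<^sub>r blk_B2 (K n) @\<^sub>r 0\<^sub>m (sz_r0 (K n)) d @\<^sub>r 0\<^sub>m (?w n) d"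
      "U n * (C n + D n * V n * F0 n) = blk_C1 (K n) @\<^sub>r blk_C2 (K n) @\<^sub>r blk_C3 (K n) @\<^sub>r 0\<^sub>m (?w n) d"
    if "n \<ge> n0" for n
    using Q[OF that] unfolding Q_def by simp_all
  show thesis
  proof (rule that[of F1 F0]; (intro allI impI)?)
    fix s2 s1 s0 w :: "nat \<Rightarrow> nat"
    assume s: "\<forall>n\<ge>n0. s2 n = sz_r2 (K n) \<and> s1 n = sz_r1 (K n) \<and> s0 n = sz_r0 (K n) \<and>
        s2 n + s1 n + s0 n + w n = m"
    have blocks: "nonsingular m (U n) \<and> s2 n + s1 n + s0 n + w n = m \<and>
      blk_A1 (K n) \<in> carrier_mat (s2 n) d \<and> blk_B1 (K n) \<in> carrier_mat (s2 n) d \<and>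
      blk_C1 (K n) \<in> carrier_mat (s2 n) d \<and> blk_B2 (K n) \<in> carrier_mat (s1 n) d \<and>
      blk_C2 (K n) \<in> carrier_mat (s1 n) d \<and> blk_C3 (K n) \<in> carrier_mat (s0 n) d \<and>
      U n * A n = blk_A1 (K n) @\<^sub>r 0\<^sub>m (s1 n) d @\<^sub>r 0\<^sub>m (s0 n) d @\<^sub>r 0\<^sub>m (w n) d \<and>
      U n * (B n + D n * V n * F1 n) = blk_B1 (K n) @\<^sub>r blk_B2 (K n) @\<^sub>r 0\<^sub>m (s0 n) d @\<^sub>r 0\<^sub>m (w n) d \<and>
      U n * (C n + D n * V n * F0 n) = blk_C1 (K n) @\<^sub>r blk_C2 (K n) @\<^sub>r blk_C3 (K n) @\<^sub>r 0\<^sub>m (w n) d"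
      if n: "n \<ge> n0" for n
    proof -
      note U = condensed_formD(1)[OF cf n] and adm = condensed_formD(3)[OF cf n]
        and UA = condensed_formD(4)[OF cf n]
      \<comment> \<open>Both lists of block heights add up to \<open>m\<close>, which determines the
        number of zero rows.\<close>
      have w: "w n = ?w n"
        using s[rule_format, OF n] adm unfolding admissible_blocks_def by linarith
      have UA': "U n * A n = blk_A1 (K n) @\<^sub>r 0\<^sub>m (sz_r1 (K n)) d @\<^sub>r 0\<^sub>m (sz_r0 (K n)) d @\<^sub>r 0\<^sub>m (?w n) d"
        unfolding UA condensed_A_def by (simp add: append_rows_zero add.assoc)
      have sn: "s2 n = sz_r2 (K n)" "s1 n = sz_r1 (K n)" "s0 n = sz_r0 (K n)"
          "s2 n + s1 n + s0 n + w n = m"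
        using s[rule_format, OF n] by blast+
      note b = adm[unfolded admissible_blocks_def]
      show ?thesis
        by (intro conjI U sn(4); (unfold sn(1-3) w)?; (rule UA' F(3)[OF n] F(4)[OF n])?) (use b in blast)+
    qed
    \<comment> \<open>The scaling matrices are the given \<open>U\<close>. Feedback leaves the
      blocks \<open>blk_A1\<close>, \<open>blk_B2\<close> and \<open>blk_C3\<close> unchanged, so
      the rank condition of the closed loop is the assumed one.\<close>
    show "strangeness_free_with_sizes n0 m d s2 s1 s0 w
        A (\<lambda>n. B n + D n * V n * F1 n) (\<lambda>n. C n + D n * V n * F0 n)"
      unfolding strangeness_free_with_sizes_def
      by (rule exI[of _ U], rule exI[of _ "\<lambda>n. blk_A1 (K n)"], rule exI[of _ "\<lambda>n. blk_B1 (K n)"],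
          rule exI[of _ "\<lambda>n. blk_B2 (K n)"], rule exI[of _ "\<lambda>n. blk_C1 (K n)"],
          rule exI[of _ "\<lambda>n. blk_C2 (K n)"], rule exI[of _ "\<lambda>n. blk_C3 (K n)"])
        (intro conjI[OF _ rank] allI impI blocks)
  next
    show "F1 n \<in> carrier_mat p d \<and> F0 n \<in> carrier_mat p d" if "n \<ge> n0" for n
      using F(1,2)[OF that] by (rule conjI)
  qed
qed

text \<open>The block sizes of a condensed form may change with \<open>n\<close>, while
  strangeness-freeness asks for fixed ones. The second part therefore treats the varying sizes first
  and derives \<open>strangeness_free\<close>, with the same feedback, when the three leading sizes
  are constant. It covers every condensed form of the system, not only the one constructed for the
  first part.\<close>

theorem theorem4p4:
  fixes n0 m d p :: nat
    and A B C D :: "nat \<Rightarrow> real mat"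
    and f :: "nat \<Rightarrow> real vec"
  assumes "\<And>n. n \<ge> n0 \<Longrightarrow> A n \<in> carrier_mat m d"
    and "\<And>n. n \<ge> n0 \<Longrightarrow> B n \<in> carrier_mat m d"
    and "\<And>n. n \<ge> n0 \<Longrightarrow> C n \<in> carrier_mat m d"
    and "\<And>n. n \<ge> n0 \<Longrightarrow> D n \<in> carrier_mat m p"
    and "\<And>n. n \<ge> n0 \<Longrightarrow> f n \<in> carrier_vec m"
  shows
    "(\<exists>U V K. condensed_form n0 m d p A B C D U V K \<and>
        (\<forall>x v. (\<forall>n\<ge>n0. x n \<in> carrier_vec d \<and> v n \<in> carrier_vec p) \<longrightarrow>
           (descriptor_system n0 A B C D f x (\<lambda>n. V n *\<^sub>v v n) \<longleftrightarrow>
            descriptor_system n0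
              (\<lambda>n. condensed_A d (K n)) (\<lambda>n. condensed_B d (K n))
              (\<lambda>n. condensed_C d (K n)) (\<lambda>n. condensed_D p (K n))
              (\<lambda>n. U n *\<^sub>v f n) x v))) \<and>
     (\<forall>U V K. condensed_form n0 m d p A B C D U V K \<longrightarrow>
        (\<forall>n\<ge>n0. full_row_rank (blk_A1 (K n) @\<^sub>r blk_B2 (K (n + 1)) @\<^sub>r blk_C3 (K (n + 2)))) \<longrightarrow>
        (\<exists>F1 F0. (\<forall>n\<ge>n0. F1 n \<in> carrier_mat p d \<and> F0 n \<in> carrier_mat p d) \<and>
           (\<exists>s2 s1 s0 w. strangeness_free_with_sizes n0 m d s2 s1 s0 w
              A (\<lambda>n. B n + D n * V n * F1 n) (\<lambda>n. C n + D n * V n * F0 n)) \<and>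
           ((\<forall>n\<ge>n0. sz_r2 (K n) = sz_r2 (K n0) \<and> sz_r1 (K n) = sz_r1 (K n0) \<and>
                     sz_r0 (K n) = sz_r0 (K n0)) \<longrightarrow>
            strangeness_free n0 m d
              A (\<lambda>n. B n + D n * V n * F1 n) (\<lambda>n. C n + D n * V n * F0 n))))"
proof (intro conjI allI impI)
  obtain U V K where cf: "condensed_form n0 m d p A B C D U V K"
    by (rule condensed_form_exists[OF assms(1-4)])
  show "\<exists>U V K. condensed_form n0 m d p A B C D U V K \<and>
      (\<forall>x v. (\<forall>n\<ge>n0. x n \<in> carrier_vec d \<and> v n \<in> carrier_vec p) \<longrightarrow>
         (descriptor_system n0 A B C D f x (\<lambda>n. V n *\<^sub>v v n) \<longleftrightarrow>
          descriptor_system n0 (\<lambda>n. condensed_A d (K n)) (\<lambda>n. condensed_B d (K n))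
            (\<lambda>n. condensed_C d (K n)) (\<lambda>n. condensed_D p (K n)) (\<lambda>n. U n *\<^sub>v f n) x v))"
  proof (intro exI conjI allI impI)
    fix x v :: "nat \<Rightarrow> real vec"
    assume "\<forall>n\<ge>n0. x n \<in> carrier_vec d \<and> v n \<in> carrier_vec p"
    then show "descriptor_system n0 A B C D f x (\<lambda>n. V n *\<^sub>v v n) \<longleftrightarrow>
          descriptor_system n0 (\<lambda>n. condensed_A d (K n)) (\<lambda>n. condensed_B d (K n))
            (\<lambda>n. condensed_C d (K n)) (\<lambda>n. condensed_D p (K n)) (\<lambda>n. U n *\<^sub>v f n) x v"
      by (intro condensed_form_descriptor_system_iff[OF cf assms]) auto
  qed (rule cf)
next
  fix U V K
  assume cf: "condensed_form n0 m d p A B C D U V K"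
    and rank: "\<forall>n\<ge>n0. full_row_rank (blk_A1 (K n) @\<^sub>r blk_B2 (K (n + 1)) @\<^sub>r blk_C3 (K (n + 2)))"
  have sizes: "sz_r2 (K n) + sz_r1 (K n) + sz_r0 (K n) \<le> m" if "n \<ge> n0" for n
    using condensed_formD(3)[OF cf that] unfolding admissible_blocks_def by linarith
  let ?sf = "\<lambda>s2 s1 s0 w F1 F0. strangeness_free_with_sizes n0 m d s2 s1 s0 w
    A (\<lambda>n. B n + D n * V n * F1 n) (\<lambda>n. C n + D n * V n * F0 n)"
  obtain F1 F0 where F: "\<forall>n\<ge>n0. F1 n \<in> carrier_mat p d \<and> F0 n \<in> carrier_mat p d"
    and sf: "\<forall>s2 s1 s0 w. (\<forall>n\<ge>n0. s2 n = sz_r2 (K n) \<and> s1 n = sz_r1 (K n) \<and>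
        s0 n = sz_r0 (K n) \<and> s2 n + s1 n + s0 n + w n = m) \<longrightarrow> ?sf s2 s1 s0 w F1 F0"
    by (rule condensed_form_closed_loop[OF cf assms(2-4) rank])
  \<comment> \<open>The truncated difference is the true number of remaining rows, because
    \<open>sizes\<close> bounds the sum of the three heights by \<open>m\<close>.\<close>
  have varying: "?sf (\<lambda>n. sz_r2 (K n)) (\<lambda>n. sz_r1 (K n)) (\<lambda>n. sz_r0 (K n))
      (\<lambda>n. m - (sz_r2 (K n) + sz_r1 (K n) + sz_r0 (K n))) F1 F0"
    using sizes by (intro sf[rule_format]) auto
  have const: "strangeness_free n0 m d A (\<lambda>n. B n + D n * V n * F1 n) (\<lambda>n. C n + D n * V n * F0 n)"
    if "\<forall>n\<ge>n0. sz_r2 (K n) = sz_r2 (K n0) \<and> sz_r1 (K n) = sz_r1 (K n0) \<and> sz_r0 (K n) = sz_r0 (K n0)"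
  proof -
    \<comment> \<open>The sizes at \<open>n0\<close> serve as the constant sizes; by assumption they
      agree with those at every later time.\<close>
    have "?sf (\<lambda>_. sz_r2 (K n0)) (\<lambda>_. sz_r1 (K n0)) (\<lambda>_. sz_r0 (K n0))
        (\<lambda>_. m - (sz_r2 (K n0) + sz_r1 (K n0) + sz_r0 (K n0))) F1 F0"
    proof (rule sf[rule_format])
      fix n
      assume "n \<ge> n0"
      then have "sz_r2 (K n) = sz_r2 (K n0) \<and> sz_r1 (K n) = sz_r1 (K n0) \<and> sz_r0 (K n) = sz_r0 (K n0)"
        using that by blast
      then show "sz_r2 (K n0) = sz_r2 (K n) \<and> sz_r1 (K n0) = sz_r1 (K n) \<and> sz_r0 (K n0) = sz_r0 (K n) \<and>
          sz_r2 (K n0) + sz_r1 (K n0) + sz_r0 (K n0) + (m - (sz_r2 (K n0) + sz_r1 (K n0) + sz_r0 (K n0))) = m"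
        using sizes[of n0] by simp
    qed
    then show ?thesis unfolding strangeness_free_def by (intro exI)
  qed
  show "\<exists>F1 F0. (\<forall>n\<ge>n0. F1 n \<in> carrier_mat p d \<and> F0 n \<in> carrier_mat p d) \<and>
      (\<exists>s2 s1 s0 w. ?sf s2 s1 s0 w F1 F0) \<and>
      ((\<forall>n\<ge>n0. sz_r2 (K n) = sz_r2 (K n0) \<and> sz_r1 (K n) = sz_r1 (K n0) \<and> sz_r0 (K n) = sz_r0 (K n0)) \<longrightarrow>
       strangeness_free n0 m d A (\<lambda>n. B n + D n * V n * F1 n) (\<lambda>n. C n + D n * V n * F0 n))"
  proof (rule exI[of _ F1], rule exI[of _ F0], intro conjI)
    show "\<exists>s2 s1 s0 w. ?sf s2 s1 s0 w F1 F0"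
      using varying by (intro exI)
  qed (rule F, rule impI, rule const)
qed

end
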